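(* Let $A$ be a linearly ordered alphabet with $|A|=k$. (1) $G_{k,1}=\mathrm{lp}G_{k,1}\cdot F_{k,1}$, and every $\varphi\in G_{k,1}$ has a unique factorization $\varphi=\pi\cdot f$ with $\pi\in\mathrm{lp}G_{k,1}$ and $f\in F_{k,1}$. (2) Symmetrically, $G_{k,1}=F_{k,1}\cdot\mathrm{lp}G_{k,1}$, with unique factorization. (3) $T_{k,1}=\mathrm{lp}T_{k,1}\cdot F_{k,1}=F_{k,1}\cdot\mathrm{lp}T_{k,1}$, with unique factorization in both cases.
   Context: Fix a finite linearly ordered alphabet $A$ with $|A|=k\ge 2$; $A^*$ is the set of finite words over $A$. A right ideal of $A^*$ is a set $R$ with $RA^*\subseteq R$; it is essential if it meets every non-empty right ideal. Every right ideal has a unique minimal generating set, which is a prefix code; it is a maximal prefix code iff the right ideal is essential. An isomorphism $\varphi:R_1\to R_2$ between right ideals is a bijection with $\varphi(rz)=\varphi(r)z$ for all $r\in R_1$, $z\in A^*$. Every isomorphism between finitely generated essential right ideals has a unique maximal extension to an isomorphism between essential right ideals. $G_{k,1}$ is the group of all maximally extended isomorphisms between finitely generated essential right ideals of $A^*$, with multiplication: composition (acting on the left) followed by maximal extension. Dictionary order: $x_1\le_d x_2$ iff $x_1$ is a prefix of $x_2$, or $x_1=pa_1v_1$, $x_2=pa_2v_2$ with $p$ the longest common prefix, $a_1,a_2\in A$, $a_1<a_2$. $F_{k,1}$ is the subgroup of elements $\varphi\in G_{k,1}$ preserving the dictionary order: $x_1\le_d x_2\iff\varphi(x_1)\le_d\varphi(x_2)$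 for all $x_1,x_2\in\mathrm{Dom}(\varphi)$. A cyclical order of a finite maximal prefix code $P$ is a listing of $P$ that is a cyclic permutation of its listing in dictionary order. $T_{k,1}$ is the subgroup of $\varphi\in G_{k,1}$ that cyclically preserve the dictionary order: for all finite sequences $(x_0,\dots,x_{n-1})$ in $\mathrm{Dom}(\varphi)$, it is a cyclical order of some finite maximal prefix code iff $(\varphi(x_0),\dots,\varphi(x_{n-1}))$ is. $\mathrm{lp}G_{k,1}=\{\varphi\in G_{k,1}:|\varphi(x)|=|x|\ \forall x\in\mathrm{Dom}(\varphi)\}$ and $\mathrm{lp}T_{k,1}=T_{k,1}\cap\mathrm{lp}G_{k,1}$. *)

theory Defs
  imports "HOL-Algebra.Coset" "HOL-Library.Sublist" "HOL-Library.List_Lexorder"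
begin

text \<open>
  The alphabet is a type of class \<open>{finite, linorder}\<close>, and words are lists.
  A function from one right ideal onto another is a partial map on words whose
  domain and range are the two ideals, so that equality of maps includes equality of domains.
\<close>

type_synonym 'a wmap = "'a list \<rightharpoonup> 'a list"

definition right_ideal :: "'a list set \<Rightarrow> bool" where
  "right_ideal R \<longleftrightarrow> (\<forall>r\<in>R. \<forall>z. r @ z \<in> R)"

definition essential_ideal :: "'a list set \<Rightarrow> bool" where
  "essential_ideal R \<longleftrightarrow>
     right_ideal R \<and> (\<forall>S. right_ideal S \<and> S \<noteq> {} \<longrightarrow> R \<inter> S \<noteq> {})"

definition finitely_generated :: "'a list set \<Rightarrow> bool" where
  "finitely_generated R \<longleftrightarrow> (\<exists>C. finite C \<and> R = {c @ z | c z. c \<in> C})"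

definition ideal_iso :: "'a wmap \<Rightarrow> bool" where
  "ideal_iso \<phi> \<longleftrightarrow>
     right_ideal (dom \<phi>) \<and> right_ideal (ran \<phi>) \<and> inj_on \<phi> (dom \<phi>) \<and>
     (\<forall>r\<in>dom \<phi>. \<forall>z. the (\<phi> (r @ z)) = the (\<phi> r) @ z)"

definition essential_iso :: "'a wmap \<Rightarrow> bool" where
  "essential_iso \<phi> \<longleftrightarrow>
     ideal_iso \<phi> \<and> essential_ideal (dom \<phi>) \<and> essential_ideal (ran \<phi>)"

definition fg_essential_iso :: "'a wmap \<Rightarrow> bool" where
  "fg_essential_iso \<phi> \<longleftrightarrow>
     essential_iso \<phi> \<and> finitely_generated (dom \<phi>) \<and> finitely_generated (ran \<phi>)"

definition maximal_extension :: "'a wmap \<Rightarrow> 'a wmap \<Rightarrow> bool" where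
  "maximal_extension \<phi> \<psi> \<longleftrightarrow>
     essential_iso \<psi> \<and> \<phi> \<subseteq>\<^sub>m \<psi> \<and>
     (\<forall>\<chi>. essential_iso \<chi> \<and> \<psi> \<subseteq>\<^sub>m \<chi> \<longrightarrow> \<chi> = \<psi>)"

definition max_ext :: "'a wmap \<Rightarrow> 'a wmap" where
  "max_ext \<phi> = (THE \<psi>. maximal_extension \<phi> \<psi>)"

definition thompson_G :: "'a wmap monoid" where
  "thompson_G =
     \<lparr>carrier = {\<phi>. fg_essential_iso \<phi> \<and> maximal_extension \<phi> \<phi>},
      mult = (\<lambda>\<psi> \<phi>. max_ext (\<psi> \<circ>\<^sub>m \<phi>)),
      one = Some\<rparr>"

text \<open>
  The dictionary order is the order on lists provided by \<open>List_Lexorder\<close>.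
\<close>

lemma dictionary_order_iff:
  fixes x y :: "'a::linorder list"
  shows "x \<le> y \<longleftrightarrow>
     prefix x y \<or> (\<exists>p a b u v. x = p @ a # u \<and> y = p @ b # v \<and> a < b)"
proof -
  have "prefix x y \<longleftrightarrow> x = y \<or> (\<exists>a v. y = x @ a # v)"
    by (metis append_Nil2 neq_Nil_conv prefix_def)
  moreover have "x < y \<longleftrightarrow>
     (\<exists>a v. y = x @ a # v) \<or>
     (\<exists>p a b u v. x = p @ a # u \<and> y = p @ b # v \<and> a < b)"
    by (simp add: list_less_def lexord_def) blast
  ultimately show ?thesis
    by (simp add: le_less) blast
qed

definition thompson_F :: "'a::linorder wmap set" where
  "thompson_F =
     {\<phi> \<in> carrier thompson_G.
        \<forall>x\<in>dom \<phi>. \<forall>y\<in>dom \<phi>. x \<le> y \<longleftrightarrow> the (\<phi> x) \<le> the (\<phi> y)}"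

definition prefix_code :: "'a list set \<Rightarrow> bool" where
  "prefix_code P \<longleftrightarrow> (\<forall>x\<in>P. \<forall>y\<in>P. prefix x y \<longrightarrow> x = y)"

definition maximal_prefix_code :: "'a list set \<Rightarrow> bool" where
  "maximal_prefix_code P \<longleftrightarrow>
     prefix_code P \<and> (\<forall>Q. prefix_code Q \<and> P \<subseteq> Q \<longrightarrow> Q = P)"

definition cyclical_order :: "'a::linorder list set \<Rightarrow> 'a list list \<Rightarrow> bool" where
  "cyclical_order P xs \<longleftrightarrow> (\<exists>n. xs = rotate n (sorted_list_of_set P))"

definition cyclical_code_order :: "'a::linorder list list \<Rightarrow> bool" where
  "cyclical_code_order xs \<longleftrightarrow>
     (\<exists>P. finite P \<and> maximal_prefix_code P \<and> cyclical_order P xs)"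

definition thompson_T :: "'a::linorder wmap set" where
  "thompson_T =
     {\<phi> \<in> carrier thompson_G.
        \<forall>xs. set xs \<subseteq> dom \<phi> \<longrightarrow>
          (cyclical_code_order xs \<longleftrightarrow> cyclical_code_order (map (\<lambda>x. the (\<phi> x)) xs))}"

definition lp_G :: "'a wmap set" where
  "lp_G = {\<phi> \<in> carrier thompson_G. \<forall>x\<in>dom \<phi>. length (the (\<phi> x)) = length x}"

definition lp_T :: "'a::linorder wmap set" where
  "lp_T = thompson_T \<inter> lp_G"

definition unique_factorization :: "'a wmap set \<Rightarrow> 'a wmap set \<Rightarrow> 'a wmap set \<Rightarrow> bool" where
  "unique_factorization S X Y \<longleftrightarrow>
     (\<forall>\<phi>\<in>S. \<exists>!(\<alpha>, \<beta>). \<alpha> \<in> X \<and> \<beta> \<in> Y \<and> \<phi> = \<alpha> \<otimes>\<^bsub>thompson_G\<^esub> \<beta>)"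

end

theory Submission
  imports Defs
begin

text \<open>
  Over a finite alphabet a right ideal is essential and finitely generated iff it contains all
  sufficiently long words, and two isomorphisms have the same maximal extension iff they agree on
  all sufficiently long words. This makes the group laws and the subgroup properties pointwise
  statements. For the factorization of \<open>\<phi>\<close>, take \<open>n\<close> so large that the image of \<open>\<phi>\<close> contains
  \<open>A\<^sup>n\<close>. Some permutation of \<open>A\<^sup>n\<close>, applied after \<open>\<phi>\<close>, makes it order preserving on the maximal
  prefix code \<open>\<phi>\<close>-preimage of \<open>A\<^sup>n\<close>, and such a permutation extends to a length-preserving element.
  The factors are unique because an order-preserving permutation of \<open>A\<^sup>n\<close> is the identity. The
  opposite order of factors follows by inversion, and the statement about \<open>T\<close> follows because \<open>T\<close>
  is a subgroup containing \<open>F\<close>: membership in \<open>T\<close> means preserving the ternary cyclic order on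
  pairwise prefix-incomparable words.
\<close>

section \<open>Isomorphisms defined on all long words\<close>

definition deep :: "'a list set \<Rightarrow> bool" where
  "deep R \<longleftrightarrow> (\<exists>n. \<forall>w. n \<le> length w \<longrightarrow> w \<in> R)"

lemma deep_mono: "deep R \<Longrightarrow> R \<subseteq> S \<Longrightarrow> deep S"
  unfolding deep_def by blast

lemma right_ideal_append: "right_ideal R \<Longrightarrow> r \<in> R \<Longrightarrow> r @ z \<in> R"
  unfolding right_ideal_def by blast

lemma deep_imp_essential:
  assumes "right_ideal R" "deep R"
  shows "essential_ideal R"
  unfolding essential_ideal_def
proof (intro conjI allI impI)
  fix S :: "'a list set"
  assume S: "right_ideal S \<and> S \<noteq> {}"
  then obtain s where s: "s \<in> S" by blast
  obtain n where n: "\<And>w. n \<le> length w \<Longrightarrow> w \<in> R"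
    using assms(2) unfolding deep_def by blast
  \<comment> \<open>The default value \<open>undefined\<close> only serves as some letter: padding
    keeps the word in \<open>S\<close> and makes it long enough to lie in \<open>R\<close>.\<close>
  have "s @ replicate n undefined \<in> R \<inter> S"
    using n S s by (simp add: right_ideal_append)
  then show "R \<inter> S \<noteq> {}" by blast
qed (fact assms(1))

text \<open>The members of length at most \<open>n\<close> generate, since a longer word extends its
  prefix of length \<open>n\<close>, which is itself in \<open>R\<close>. They are finitely many
  because the alphabet is finite.\<close>

lemma deep_imp_finitely_generated:
  fixes R :: "'a::finite list set"
  assumes "right_ideal R" "deep R"
  shows "finitely_generated R"
proof -
  obtain n where n: "\<And>w. n \<le> length w \<Longrightarrow> w \<in> R"
    using assms(2) unfolding deep_def by blast
  let ?C = "{c \<in> R. length c \<le> n}"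
  have "finite {c :: 'a list. set c \<subseteq> UNIV \<and> length c \<le> n}"
    by (rule finite_lists_length_le) simp
  then have "finite ?C"
    by (rule rev_finite_subset) auto
  moreover have "R = {c @ z | c z. c \<in> ?C}"
  proof (intro equalityI subsetI)
    fix w assume "w \<in> R"
    show "w \<in> {c @ z | c z. c \<in> ?C}"
    proof (cases "length w \<le> n")
      case True
      with \<open>w \<in> R\<close> have "w \<in> ?C" "w = w @ []" by auto
      then show ?thesis by blast
    next
      case False
      then have "take n w \<in> ?C" "w = take n w @ drop n w" by (auto intro: n)
      then show ?thesis by blast
    qed
  qed (use assms(1) in \<open>auto simp: right_ideal_append\<close>)
  ultimately show ?thesis unfolding finitely_generated_def by blast
qed

text \<open>Essentiality makes \<open>R\<close> meet the principal right ideal of \<open>w\<close>,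
  which yields a generator comparable with \<open>w\<close>. If \<open>w\<close> is at least as long
  as every generator, that generator is a prefix of \<open>w\<close>.\<close>

lemma essential_fg_imp_deep:
  assumes "essential_ideal R" "finitely_generated R"
  shows "deep R"
proof -
  obtain C where C: "finite C" "R = {c @ z | c z. c \<in> C}"
    using assms(2) unfolding finitely_generated_def by blast
  have "w \<in> R" if w: "Max (length ` C) \<le> length w" for w
  proof -
    have "right_ideal {w @ z | z. True}" "{w @ z | z. True} \<noteq> {}"
      by (auto simp: right_ideal_def)
    then have "R \<inter> {w @ z | z. True} \<noteq> {}"
      using assms(1) unfolding essential_ideal_def by blast
    then obtain z c u where z: "w @ z = c @ u" "c \<in> C"
      using C(2) by auto
    have "length c \<le> length w"
      using C(1) z(2) w by (meson Max_ge finite_imageI imageI le_trans)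
    with z(1) have "prefix c w"
      by (metis prefixI prefix_length_prefix)
    then show "w \<in> R"
      using C(2) z(2) by (auto simp: prefix_def)
  qed
  then show ?thesis unfolding deep_def by blast
qed

text \<open>Phrased with \<open>Some\<close>, the first clause already forces domain and range to be
  right ideals; given this, the two \<open>deep\<close> clauses stand for "essential and finitely
  generated".\<close>

definition deep_iso :: "'a wmap \<Rightarrow> bool" where
  "deep_iso \<phi> \<longleftrightarrow>
     (\<forall>x y z. \<phi> x = Some y \<longrightarrow> \<phi> (x @ z) = Some (y @ z)) \<and>
     (\<forall>x x' y. \<phi> x = Some y \<longrightarrow> \<phi> x' = Some y \<longrightarrow> x = x') \<and>
     deep (dom \<phi>) \<and> deep (ran \<phi>)"

lemma deep_iso_append: "deep_iso \<phi> \<Longrightarrow> \<phi> x = Some y \<Longrightarrow> \<phi> (x @ z) = Some (y @ z)"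
  unfolding deep_iso_def by blast

lemma deep_iso_inj: "deep_iso \<phi> \<Longrightarrow> \<phi> x = Some y \<Longrightarrow> \<phi> x' = Some y \<Longrightarrow> x = x'"
  unfolding deep_iso_def by blast

lemma deep_iso_dom: "deep_iso \<phi> \<Longrightarrow> deep (dom \<phi>)"
  unfolding deep_iso_def by blast

lemma fg_essential_iso_iff:
  fixes \<phi> :: "'a::finite wmap"
  shows "fg_essential_iso \<phi> \<longleftrightarrow> deep_iso \<phi>"
proof
  assume L: "fg_essential_iso \<phi>"
  then have I: "ideal_iso \<phi>"
    unfolding fg_essential_iso_def essential_iso_def by blast
  have "\<phi> (x @ z) = Some (y @ z)" if "\<phi> x = Some y" for x y z
  proof -
    have "x @ z \<in> dom \<phi>" "the (\<phi> (x @ z)) = the (\<phi> x) @ z"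
      using I that unfolding ideal_iso_def right_ideal_def by blast+
    with that show ?thesis by auto
  qed
  moreover have "x = x'" if "\<phi> x = Some y" "\<phi> x' = Some y" for x x' y
    using I that unfolding ideal_iso_def inj_on_def by (metis domI)
  ultimately show "deep_iso \<phi>"
    using L essential_fg_imp_deep
    unfolding deep_iso_def fg_essential_iso_def essential_iso_def by blast
next
  assume R: "deep_iso \<phi>"
  have d: "right_ideal (dom \<phi>)"
    unfolding right_ideal_def using deep_iso_append[OF R] by blast
  have r: "right_ideal (ran \<phi>)"
    unfolding right_ideal_def ran_def using deep_iso_append[OF R] by blast
  have "inj_on \<phi> (dom \<phi>)"
    unfolding inj_on_def using deep_iso_inj[OF R] by (metis domD)
  moreover have "the (\<phi> (x @ z)) = the (\<phi> x) @ z" if "x \<in> dom \<phi>" for x z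
    using that deep_iso_append[OF R] by fastforce
  ultimately have "ideal_iso \<phi>"
    unfolding ideal_iso_def using d r by blast
  then show "fg_essential_iso \<phi>"
    using d r R deep_imp_essential deep_imp_finitely_generated
    unfolding fg_essential_iso_def essential_iso_def deep_iso_def by blast
qed

text \<open>Everything after a prefix in the domain is copied unchanged, so images become
  arbitrarily long. This guarantees that images of long words reach the domain of the next map in a
  composite.\<close>

lemma deep_iso_proper:
  assumes "deep_iso \<phi>"
  obtains n where "\<And>w. n \<le> length w \<Longrightarrow> \<exists>y. \<phi> w = Some y \<and> m \<le> length y"
proof -
  obtain n where n: "\<And>w. n \<le> length w \<Longrightarrow> w \<in> dom \<phi>"
    using deep_iso_dom[OF assms] unfolding deep_def by blast
  have "\<exists>y. \<phi> w = Some y \<and> m \<le> length y" if w: "n + m \<le> length w" for w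
  proof -
    have "take n w \<in> dom \<phi>" using n w by simp
    then obtain y where "\<phi> (take n w) = Some y" by blast
    then have "\<phi> (take n w @ drop n w) = Some (y @ drop n w)"
      by (rule deep_iso_append[OF assms])
    then show ?thesis using w by simp
  qed
  then show ?thesis using that by blast
qed

lemma deep_iso_Some: "deep_iso Some"
  unfolding deep_iso_def deep_def by (auto simp: ran_def)

section \<open>Partial inverses and composites of isomorphisms\<close>

definition pinv :: "('a \<rightharpoonup> 'b) \<Rightarrow> ('b \<rightharpoonup> 'a)" where
  "pinv \<phi> y = (if y \<in> ran \<phi> then Some (THE x. \<phi> x = Some y) else None)"

lemma pinv_eq_Some:
  assumes "deep_iso \<phi>"
  shows "pinv \<phi> y = Some x \<longleftrightarrow> \<phi> x = Some y"
proof
  assume "pinv \<phi> y = Some x"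
  then have "y \<in> ran \<phi>" and x: "x = (THE x. \<phi> x = Some y)"
    by (auto simp: pinv_def split: if_splits)
  then obtain x' where x': "\<phi> x' = Some y" by (auto simp: ran_def)
  then have "(THE x. \<phi> x = Some y) = x'"
    using deep_iso_inj[OF assms] by blast
  with x x' show "\<phi> x = Some y" by simp
next
  assume x: "\<phi> x = Some y"
  then have "(THE x. \<phi> x = Some y) = x"
    using deep_iso_inj[OF assms] by blast
  with x show "pinv \<phi> y = Some x" by (auto simp: pinv_def ranI)
qed

lemma dom_pinv: "dom (pinv \<phi>) = ran \<phi>"
  by (auto simp: pinv_def dom_def split: if_splits)

lemma ran_pinv: "deep_iso \<phi> \<Longrightarrow> ran (pinv \<phi>) = dom \<phi>"
  by (auto simp: ran_def pinv_eq_Some)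

lemma deep_iso_pinv:
  assumes "deep_iso \<phi>"
  shows "deep_iso (pinv \<phi>)"
  unfolding deep_iso_def pinv_eq_Some[OF assms] dom_pinv ran_pinv[OF assms]
  using assms unfolding deep_iso_def by force

lemma deep_iso_comp:
  assumes "deep_iso \<psi>" "deep_iso \<phi>"
  shows "deep_iso (\<psi> \<circ>\<^sub>m \<phi>)"
proof -
  \<comment> \<open>Stated for arbitrary maps because it is applied a second time, to the
    inverses.\<close>
  have D: "deep (dom (\<psi> \<circ>\<^sub>m \<phi>))" if d: "deep_iso \<psi>" "deep_iso \<phi>" for \<psi> \<phi> :: "'a wmap"
  proof -
    obtain n where n: "\<And>w. n \<le> length w \<Longrightarrow> \<exists>y. \<psi> w = Some y \<and> 0 \<le> length y"
      using deep_iso_proper[OF d(1)] by blast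
    obtain m where m: "\<And>w. m \<le> length w \<Longrightarrow> \<exists>y. \<phi> w = Some y \<and> n \<le> length y"
      using deep_iso_proper[OF d(2)] by blast
    have "w \<in> dom (\<psi> \<circ>\<^sub>m \<phi>)" if "m \<le> length w" for w
      using m[OF that] n by (force simp: map_comp_def)
    then show ?thesis unfolding deep_def by blast
  qed
  \<comment> \<open>Depth of the range is depth of the domain of the inverse composite.\<close>
  have "dom (pinv \<phi> \<circ>\<^sub>m pinv \<psi>) \<subseteq> ran (\<psi> \<circ>\<^sub>m \<phi>)"
    by (auto simp: dom_def ran_def map_comp_Some_iff pinv_eq_Some assms)
  then have "deep (ran (\<psi> \<circ>\<^sub>m \<phi>))"
    using D[OF deep_iso_pinv[OF assms(2)] deep_iso_pinv[OF assms(1)]] deep_mono by blast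
  moreover have "\<forall>x y z. (\<psi> \<circ>\<^sub>m \<phi>) x = Some y \<longrightarrow> (\<psi> \<circ>\<^sub>m \<phi>) (x @ z) = Some (y @ z)"
    by (auto simp: map_comp_Some_iff dest: deep_iso_append[OF assms(1)] deep_iso_append[OF assms(2)])
  moreover have "\<forall>x x' y. (\<psi> \<circ>\<^sub>m \<phi>) x = Some y \<longrightarrow> (\<psi> \<circ>\<^sub>m \<phi>) x' = Some y \<longrightarrow> x = x'"
    by (auto simp: map_comp_Some_iff dest: deep_iso_inj[OF assms(1)] deep_iso_inj[OF assms(2)])
  ultimately show ?thesis
    unfolding deep_iso_def using D[OF assms] by blast
qed

section \<open>Maximal extensions and the group\<close>

text \<open>Eventual equality. On \<open>deep_iso\<close> maps its classes correspond to the group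
  elements: \<open>ext\<close> is constant on a class and picks a representative in it.\<close>

definition agree :: "('a list \<Rightarrow> 'b) \<Rightarrow> ('a list \<Rightarrow> 'b) \<Rightarrow> bool" where
  "agree \<phi> \<psi> \<longleftrightarrow> (\<exists>n. \<forall>w. n \<le> length w \<longrightarrow> \<phi> w = \<psi> w)"

lemma agree_sym: "agree \<phi> \<psi> \<Longrightarrow> agree \<psi> \<phi>"
  unfolding agree_def by metis

lemma agree_trans:
  assumes "agree \<phi> \<psi>" "agree \<psi> \<chi>"
  shows "agree \<phi> \<chi>"
proof -
  obtain n m where "\<forall>w. n \<le> length w \<longrightarrow> \<phi> w = \<psi> w" "\<forall>w. m \<le> length w \<longrightarrow> \<psi> w = \<chi> w"
    using assms unfolding agree_def by blast
  then have "\<forall>w. n + m \<le> length w \<longrightarrow> \<phi> w = \<chi> w" by simp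
  then show ?thesis unfolding agree_def by blast
qed

lemma agree_comp_left: "agree \<phi> \<phi>' \<Longrightarrow> agree (\<psi> \<circ>\<^sub>m \<phi>) (\<psi> \<circ>\<^sub>m \<phi>')"
  unfolding agree_def by (metis map_comp_def)

text \<open>Unlike composition on the other side, this needs \<phi> to send long words to long
  words, where \<psi> and \<psi>' coincide.\<close>

lemma agree_comp_right:
  assumes "deep_iso \<phi>" "agree \<psi> \<psi>'"
  shows "agree (\<psi> \<circ>\<^sub>m \<phi>) (\<psi>' \<circ>\<^sub>m \<phi>)"
proof -
  obtain n where n: "\<And>w. n \<le> length w \<Longrightarrow> \<psi> w = \<psi>' w"
    using assms(2) unfolding agree_def by blast
  obtain m where "\<And>w. m \<le> length w \<Longrightarrow> \<exists>y. \<phi> w = Some y \<and> n \<le> length y"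
    using deep_iso_proper[OF assms(1)] by blast
  with n have "\<forall>w. m \<le> length w \<longrightarrow> (\<psi> \<circ>\<^sub>m \<phi>) w = (\<psi>' \<circ>\<^sub>m \<phi>) w"
    by (force simp: map_comp_def)
  then show ?thesis unfolding agree_def by blast
qed

text \<open>
  The maximal extension sends \<open>x\<close> to \<open>y\<close> iff \<open>\<phi>\<close> sends \<open>xz\<close> to \<open>yz\<close> for all long \<open>z\<close>; no
  reference to the domain of \<open>\<phi>\<close> is needed, so the extension depends only on long words.
\<close>

definition ext_rel :: "'a wmap \<Rightarrow> 'a list \<Rightarrow> 'a list \<Rightarrow> bool" where
  "ext_rel \<phi> x y \<longleftrightarrow> (\<exists>n. \<forall>z. n \<le> length z \<longrightarrow> \<phi> (x @ z) = Some (y @ z))"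

definition ext :: "'a wmap \<Rightarrow> 'a wmap" where
  "ext \<phi> x = (if \<exists>y. ext_rel \<phi> x y then Some (SOME y. ext_rel \<phi> x y) else None)"

lemma ext_rel_unique:
  assumes "ext_rel \<phi> x y" "ext_rel \<phi> x y'"
  shows "y = y'"
proof -
  obtain n n' where "\<And>z. n \<le> length z \<Longrightarrow> \<phi> (x @ z) = Some (y @ z)"
    "\<And>z. n' \<le> length z \<Longrightarrow> \<phi> (x @ z) = Some (y' @ z)"
    using assms unfolding ext_rel_def by blast
  from this(1)[of "replicate (n + n') undefined"] this(2)[of "replicate (n + n') undefined"]
  show ?thesis by simp
qed

lemma ext_eq_Some: "ext \<phi> x = Some y \<longleftrightarrow> ext_rel \<phi> x y"
  unfolding ext_def by (auto intro: someI dest: ext_rel_unique)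

text \<open>Reduces an equation between products in the group to eventual equality of the underlying
  composites.\<close>

lemma ext_cong:
  assumes "agree \<phi> \<psi>"
  shows "ext \<phi> = ext \<psi>"
proof -
  have I: "ext_rel \<psi> x y" if "ext_rel \<phi> x y" "agree \<phi> \<psi>" for \<phi> \<psi> :: "'a wmap" and x y
  proof -
    obtain n m where "\<And>z. n \<le> length z \<Longrightarrow> \<phi> (x @ z) = Some (y @ z)"
      and "\<And>w. m \<le> length w \<Longrightarrow> \<phi> w = \<psi> w"
      using \<open>agree \<phi> \<psi>\<close> \<open>ext_rel \<phi> x y\<close> unfolding agree_def ext_rel_def by blast
    then have "\<forall>z. n + m \<le> length z \<longrightarrow> \<psi> (x @ z) = Some (y @ z)"
      by (metis add_leD1 add_leD2 length_append trans_le_add2)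
    then show ?thesis unfolding ext_rel_def by blast
  qed
  have "ext_rel \<phi> x y = ext_rel \<psi> x y" for x y
    using I[OF _ assms] I[OF _ agree_sym[OF assms]] by blast
  then show ?thesis by (intro HOL.ext) (simp only: ext_def)
qed

lemma ext_Some: "ext Some = Some"
proof
  fix x :: "'a list"
  show "ext Some x = Some x" by (simp add: ext_eq_Some ext_rel_def)
qed

lemma ext_extends: "deep_iso \<phi> \<Longrightarrow> \<phi> x = Some y \<Longrightarrow> ext \<phi> x = Some y"
  unfolding ext_eq_Some ext_rel_def using deep_iso_append by blast

lemma map_le_ext: "deep_iso \<phi> \<Longrightarrow> \<phi> \<subseteq>\<^sub>m ext \<phi>"
  by (auto simp: map_le_def ext_extends)

lemma agree_ext:
  assumes "deep_iso \<phi>"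
  shows "agree (ext \<phi>) \<phi>"
proof -
  obtain n where "\<And>w. n \<le> length w \<Longrightarrow> w \<in> dom \<phi>"
    using deep_iso_dom[OF assms] unfolding deep_def by blast
  then show ?thesis
    unfolding agree_def by (metis assms domD ext_extends)
qed

lemma ext_idem: "deep_iso \<phi> \<Longrightarrow> ext (ext \<phi>) = ext \<phi>"
  by (rule ext_cong[OF agree_ext])

text \<open>A single bound works for both arguments, so two values of the extension can be compared
  through \<phi> after appending the same tail.\<close>

lemma ext_common_tail:
  assumes "ext \<phi> x = Some x'" "ext \<phi> y = Some y'"
  obtains n where
    "\<And>z. n \<le> length z \<Longrightarrow> \<phi> (x @ z) = Some (x' @ z) \<and> \<phi> (y @ z) = Some (y' @ z)"
proof -
  obtain n m where "\<And>z. n \<le> length z \<Longrightarrow> \<phi> (x @ z) = Some (x' @ z)"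
    "\<And>z. m \<le> length z \<Longrightarrow> \<phi> (y @ z) = Some (y' @ z)"
    using assms unfolding ext_eq_Some ext_rel_def by blast
  then show ?thesis using that[of "n + m"] by simp
qed

lemma deep_iso_ext:
  assumes "deep_iso \<phi>"
  shows "deep_iso (ext \<phi>)"
  unfolding deep_iso_def
proof (intro conjI allI impI)
  fix x y z assume "ext \<phi> x = Some y"
  then obtain n where n: "\<And>z. n \<le> length z \<Longrightarrow> \<phi> (x @ z) = Some (y @ z)"
    unfolding ext_eq_Some ext_rel_def by blast
  have "\<phi> ((x @ z) @ u) = Some ((y @ z) @ u)" if "n \<le> length u" for u
    using n[of "z @ u"] that by simp
  then show "ext \<phi> (x @ z) = Some (y @ z)"
    unfolding ext_eq_Some ext_rel_def by blast
next
  fix x x' y assume "ext \<phi> x = Some y" "ext \<phi> x' = Some y"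
  then obtain n where
    "\<And>z. n \<le> length z \<Longrightarrow> \<phi> (x @ z) = Some (y @ z) \<and> \<phi> (x' @ z) = Some (y @ z)"
    by (rule ext_common_tail) blast
  from this[of "replicate n undefined"] show "x = x'"
    using deep_iso_inj[OF assms] by fastforce
next
  have "dom \<phi> \<subseteq> dom (ext \<phi>)" "ran \<phi> \<subseteq> ran (ext \<phi>)"
    using ext_extends[OF assms] by (auto simp: ran_def)
  then show "deep (dom (ext \<phi>))" "deep (ran (ext \<phi>))"
    using assms deep_mono unfolding deep_iso_def by blast+
qed

text \<open>For long \<open>z\<close> the word \<open>x @ z\<close> lies in the domain of \<phi>, so
  \<phi> and \<chi> coincide there and \<chi> copies the tail. Only \<open>essential_iso\<close> is
  assumed of \<chi>, matching the competitors in \<open>maximal_extension\<close>.\<close>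

lemma map_le_ext_if_extends:
  assumes "deep_iso \<phi>" "essential_iso \<chi>" "\<phi> \<subseteq>\<^sub>m \<chi>"
  shows "\<chi> \<subseteq>\<^sub>m ext \<phi>"
proof -
  obtain n where n: "\<And>w. n \<le> length w \<Longrightarrow> w \<in> dom \<phi>"
    using deep_iso_dom[OF assms(1)] unfolding deep_def by blast
  have "ext \<phi> x = Some y" if x: "\<chi> x = Some y" for x y
  proof -
    have "\<phi> (x @ z) = Some (y @ z)" if "n \<le> length z" for z
    proof -
      have z: "x @ z \<in> dom \<phi>" using n that by simp
      then have "\<chi> (x @ z) = \<phi> (x @ z)"
        using assms(3) unfolding map_le_def by metis
      moreover have "the (\<chi> (x @ z)) = the (\<chi> x) @ z"
        using assms(2) x unfolding essential_iso_def ideal_iso_def by blast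
      ultimately show ?thesis using x z by auto
    qed
    then show ?thesis unfolding ext_eq_Some ext_rel_def by blast
  qed
  then show ?thesis unfolding map_le_def by force
qed

text \<open>\<open>ext \<phi>\<close> is the greatest extension, not merely a maximal one, which
  gives existence and uniqueness together.\<close>

lemma maximal_extension_iff:
  fixes \<phi> :: "'a::finite wmap"
  assumes "deep_iso \<phi>"
  shows "maximal_extension \<phi> \<psi> \<longleftrightarrow> \<psi> = ext \<phi>"
proof -
  have E: "essential_iso (ext \<phi>)"
    using deep_iso_ext[OF assms] fg_essential_iso_iff unfolding fg_essential_iso_def by blast
  have "maximal_extension \<phi> (ext \<phi>)"
    unfolding maximal_extension_def
    using E map_le_ext[OF assms] map_le_ext_if_extends[OF assms] map_le_antisym map_le_trans
    by blast
  moreover have "ext \<phi> = \<psi>" if "maximal_extension \<phi> \<psi>"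
    using that E map_le_ext_if_extends[OF assms] unfolding maximal_extension_def by blast
  ultimately show ?thesis by blast
qed

lemma max_ext_eq_ext:
  fixes \<phi> :: "'a::finite wmap"
  shows "deep_iso \<phi> \<Longrightarrow> max_ext \<phi> = ext \<phi>"
  unfolding max_ext_def by (rule the_equality) (simp_all add: maximal_extension_iff)

section \<open>The group laws and a subgroup criterion\<close>

lemma carrier_thompson_G:
  "carrier (thompson_G :: 'a::finite wmap monoid) = {\<phi>. deep_iso \<phi> \<and> ext \<phi> = \<phi>}"
  unfolding thompson_G_def by (auto simp: fg_essential_iso_iff maximal_extension_iff)

lemma one_thompson_G: "\<one>\<^bsub>thompson_G\<^esub> = Some"
  by (simp add: thompson_G_def)

lemma mult_thompson_G:
  fixes \<phi> \<psi> :: "'a::finite wmap"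
  shows "deep_iso \<psi> \<Longrightarrow> deep_iso \<phi> \<Longrightarrow> \<psi> \<otimes>\<^bsub>thompson_G\<^esub> \<phi> = ext (\<psi> \<circ>\<^sub>m \<phi>)"
  by (simp add: thompson_G_def max_ext_eq_ext deep_iso_comp)

lemma pinv_comp_agree:
  assumes "deep_iso \<phi>"
  shows "agree (pinv \<phi> \<circ>\<^sub>m \<phi>) Some"
proof -
  obtain n where "\<And>w. n \<le> length w \<Longrightarrow> w \<in> dom \<phi>"
    using deep_iso_dom[OF assms] unfolding deep_def by blast
  then show ?thesis
    unfolding agree_def by (metis assms domD map_comp_simps(2) pinv_eq_Some)
qed

lemma ext_pinv_mult:
  fixes \<phi> :: "'a::finite wmap"
  assumes "deep_iso \<phi>"
  shows "ext (pinv \<phi>) \<otimes>\<^bsub>thompson_G\<^esub> \<phi> = Some"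
proof -
  have "agree (ext (pinv \<phi>) \<circ>\<^sub>m \<phi>) Some"
    using agree_trans[OF agree_comp_right[OF assms agree_ext[OF deep_iso_pinv[OF assms]]]
        pinv_comp_agree[OF assms]] .
  then show ?thesis
    using ext_cong[of "ext (pinv \<phi>) \<circ>\<^sub>m \<phi>" Some]
    by (simp add: mult_thompson_G deep_iso_ext deep_iso_pinv assms ext_Some)
qed

lemma group_thompson_G: "group (thompson_G :: 'a::finite wmap monoid)"
proof (rule groupI)
  fix x y z :: "'a wmap"
  assume "x \<in> carrier thompson_G" "y \<in> carrier thompson_G" "z \<in> carrier thompson_G"
  then have d: "deep_iso x" "deep_iso y" "deep_iso z"
    by (auto simp: carrier_thompson_G)
  \<comment> \<open>Both bracketings agree eventually with the plain composite of the three maps,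
    which is associative.\<close>
  have "agree (ext (x \<circ>\<^sub>m y) \<circ>\<^sub>m z) ((x \<circ>\<^sub>m y) \<circ>\<^sub>m z)"
    using d by (intro agree_comp_right agree_ext deep_iso_comp)
  moreover have "agree (x \<circ>\<^sub>m ext (y \<circ>\<^sub>m z)) (x \<circ>\<^sub>m (y \<circ>\<^sub>m z))"
    using d by (intro agree_comp_left agree_ext deep_iso_comp)
  moreover have "(x \<circ>\<^sub>m y) \<circ>\<^sub>m z = x \<circ>\<^sub>m (y \<circ>\<^sub>m z)"
    by (auto simp: map_comp_def fun_eq_iff split: option.splits)
  ultimately have "agree (ext (x \<circ>\<^sub>m y) \<circ>\<^sub>m z) (x \<circ>\<^sub>m ext (y \<circ>\<^sub>m z))"
    using agree_sym agree_trans by metis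
  then show "x \<otimes>\<^bsub>thompson_G\<^esub> y \<otimes>\<^bsub>thompson_G\<^esub> z
      = x \<otimes>\<^bsub>thompson_G\<^esub> (y \<otimes>\<^bsub>thompson_G\<^esub> z)"
    using d by (simp add: mult_thompson_G deep_iso_comp deep_iso_ext ext_cong)
next
  fix x :: "'a wmap" assume x: "x \<in> carrier thompson_G"
  then have d: "deep_iso x" by (auto simp: carrier_thompson_G)
  have "Some \<circ>\<^sub>m x = x" by (auto simp: map_comp_def fun_eq_iff split: option.splits)
  with x show "\<one>\<^bsub>thompson_G\<^esub> \<otimes>\<^bsub>thompson_G\<^esub> x = x"
    by (simp add: one_thompson_G mult_thompson_G deep_iso_Some carrier_thompson_G)
  have "ext (pinv x) \<in> carrier thompson_G"
    using d by (simp add: carrier_thompson_G deep_iso_ext deep_iso_pinv ext_idem)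
  then show "\<exists>y\<in>carrier thompson_G. y \<otimes>\<^bsub>thompson_G\<^esub> x = \<one>\<^bsub>thompson_G\<^esub>"
    using ext_pinv_mult[OF d] by (auto simp: one_thompson_G)
qed (auto simp: carrier_thompson_G mult_thompson_G one_thompson_G deep_iso_Some ext_Some
       deep_iso_comp deep_iso_ext ext_idem)

lemma inv_thompson_G:
  fixes \<phi> :: "'a::finite wmap"
  assumes "\<phi> \<in> carrier thompson_G"
  shows "inv\<^bsub>thompson_G\<^esub> \<phi> = ext (pinv \<phi>)"
proof -
  interpret group "thompson_G :: 'a wmap monoid" by (rule group_thompson_G)
  have d: "deep_iso \<phi>" using assms by (auto simp: carrier_thompson_G)
  then have "ext (pinv \<phi>) \<in> carrier thompson_G"
    by (simp add: carrier_thompson_G deep_iso_ext deep_iso_pinv ext_idem)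
  then show ?thesis
    using assms ext_pinv_mult[OF d] inv_equality by (simp add: one_thompson_G)
qed

text \<open>Group inverse and product are \<open>ext\<close> applied to \<open>pinv\<close> and to a
  composite, which splits closure into three pointwise conditions. They range over all
  \<open>deep_iso\<close> maps because composites need not be maximally extended.\<close>

lemma subgroup_thompson_G:
  fixes Q :: "'a::finite wmap \<Rightarrow> bool"
  assumes "Q Some"
    and "\<And>\<phi>. deep_iso \<phi> \<Longrightarrow> Q \<phi> \<Longrightarrow> Q (ext \<phi>)"
    and "\<And>\<phi>. deep_iso \<phi> \<Longrightarrow> Q \<phi> \<Longrightarrow> Q (pinv \<phi>)"
    and "\<And>\<psi> \<phi>. deep_iso \<psi> \<Longrightarrow> deep_iso \<phi> \<Longrightarrow> Q \<psi> \<Longrightarrow> Q \<phi> \<Longrightarrow> Q (\<psi> \<circ>\<^sub>m \<phi>)"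
  shows "subgroup {\<phi> \<in> carrier thompson_G. Q \<phi>} thompson_G"
proof -
  interpret group "thompson_G :: 'a wmap monoid" by (rule group_thompson_G)
  show ?thesis
  proof (rule subgroupI)
    show "{\<phi> \<in> carrier thompson_G. Q \<phi>} \<noteq> {}"
      using one_closed assms(1) by (auto simp: one_thompson_G)
  next
    fix \<phi> assume \<phi>: "\<phi> \<in> {\<phi> \<in> carrier thompson_G. Q \<phi>}"
    then have "inv\<^bsub>thompson_G\<^esub> \<phi> = ext (pinv \<phi>)" by (simp add: inv_thompson_G)
    moreover have "Q (ext (pinv \<phi>))"
      using \<phi> assms(2,3) by (auto simp: carrier_thompson_G deep_iso_pinv)
    moreover have "inv\<^bsub>thompson_G\<^esub> \<phi> \<in> carrier thompson_G"
      using \<phi> by simp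
    ultimately show "inv\<^bsub>thompson_G\<^esub> \<phi> \<in> {\<phi> \<in> carrier thompson_G. Q \<phi>}" by simp
  next
    fix \<psi> \<phi>
    assume *: "\<psi> \<in> {\<phi> \<in> carrier thompson_G. Q \<phi>}" "\<phi> \<in> {\<phi> \<in> carrier thompson_G. Q \<phi>}"
    then have "Q (\<psi> \<otimes>\<^bsub>thompson_G\<^esub> \<phi>)"
      using assms(2,4) by (auto simp: carrier_thompson_G mult_thompson_G deep_iso_comp)
    with * show "\<psi> \<otimes>\<^bsub>thompson_G\<^esub> \<phi> \<in> {\<phi> \<in> carrier thompson_G. Q \<phi>}" by simp
  qed blast
qed

section \<open>Dictionary order and cyclic order\<close>

text \<open>Prefix-incomparable words are compared at their first differing letter, so appended
  tails have no influence.\<close>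

lemma list_less_append_iff:
  fixes xs ys :: "'a::linorder list"
  assumes "xs \<parallel> ys"
  shows "xs @ us < ys @ vs \<longleftrightarrow> xs < ys"
proof -
  obtain as b bs c cs where bc: "b \<noteq> c" and eq: "xs = as @ b # bs" "ys = as @ c # cs"
    using parallel_decomp[OF assms] by blast
  have "as @ b # zs < as @ c # ws \<longleftrightarrow> b < c" for zs ws
    using bc by (induction as) auto
  with eq show ?thesis by simp
qed

lemma list_less_append_cancel:
  fixes xs ys zs :: "'a::linorder list"
  shows "zs @ xs < zs @ ys \<longleftrightarrow> xs < ys"
  by (induction zs) auto

lemma prefix_imp_list_le: "prefix xs ys \<Longrightarrow> xs \<le> (ys :: 'a::linorder list)"
  by (simp add: dictionary_order_iff)

text \<open>One direction is compatibility with appending; the other combines it with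
  injectivity.\<close>

lemma prefix_image_iff:
  assumes "deep_iso \<phi>" "\<phi> x = Some x'" "\<phi> y = Some y'"
  shows "prefix x' y' \<longleftrightarrow> prefix x y"
proof
  assume "prefix x y"
  then obtain z where "y = x @ z" by (auto simp: prefix_def)
  with assms deep_iso_append have "y' = x' @ z" by fastforce
  then show "prefix x' y'" by simp
next
  assume "prefix x' y'"
  then obtain z where z: "y' = x' @ z" by (auto simp: prefix_def)
  have "\<phi> (x @ z) = Some y'" using assms z deep_iso_append by blast
  then have "y = x @ z" using assms deep_iso_inj by blast
  then show "prefix x y" by simp
qed

lemma parallel_image_iff:
  assumes "deep_iso \<phi>" "\<phi> x = Some x'" "\<phi> y = Some y'"
  shows "x' \<parallel> y' \<longleftrightarrow> x \<parallel> y"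
  using prefix_image_iff[OF assms] prefix_image_iff[OF assms(1,3,2)]
  by (simp add: parallel_def)

text \<open>Restricting to incomparable pairs makes the condition insensitive to common tails, hence
  stable under \<open>ext\<close>. Comparable pairs keep their order automatically, and linearity of
  the order supplies the converse implication.\<close>

definition order_preserving :: "'a::linorder wmap \<Rightarrow> bool" where
  "order_preserving \<phi> \<longleftrightarrow>
     (\<forall>x y x' y'. \<phi> x = Some x' \<longrightarrow> \<phi> y = Some y' \<longrightarrow> x \<parallel> y \<longrightarrow> x < y \<longrightarrow> x' < y')"

lemma order_preservingD:
  "order_preserving \<phi> \<Longrightarrow> \<phi> x = Some x' \<Longrightarrow> \<phi> y = Some y' \<Longrightarrow> x \<parallel> y \<Longrightarrow> x < y \<Longrightarrow> x' < y'"
  unfolding order_preserving_def by blast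

lemma order_preserving_iff:
  assumes "deep_iso \<phi>"
  shows "order_preserving \<phi> \<longleftrightarrow>
    (\<forall>x\<in>dom \<phi>. \<forall>y\<in>dom \<phi>. x \<le> y \<longleftrightarrow> the (\<phi> x) \<le> the (\<phi> y))"
proof
  assume L: "order_preserving \<phi>"
  show "\<forall>x\<in>dom \<phi>. \<forall>y\<in>dom \<phi>. x \<le> y \<longleftrightarrow> the (\<phi> x) \<le> the (\<phi> y)"
  proof (intro ballI)
    fix x y assume "x \<in> dom \<phi>" "y \<in> dom \<phi>"
    then obtain x' y' where x: "\<phi> x = Some x'" and y: "\<phi> y = Some y'" by blast
    have "x \<le> y \<longleftrightarrow> x' \<le> y'"
    proof (cases "x \<parallel> y")
      case True
      then have "x \<noteq> y" "y \<parallel> x" by (auto simp: parallel_def)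
      then show ?thesis
        using order_preservingD[OF L x y True] order_preservingD[OF L y x]
        by (meson linorder_neqE less_imp_le not_le)
    next
      case False
      then consider "prefix x y" | "prefix y x" by (auto simp: parallel_def)
      then show ?thesis
      proof cases
        case 1
        then show ?thesis
          using prefix_image_iff[OF assms x y] by (simp add: prefix_imp_list_le)
      next
        case 2
        then have "y \<le> x" "y' \<le> x'"
          using prefix_image_iff[OF assms y x] by (simp_all add: prefix_imp_list_le)
        \<comment> \<open>Since \<open>y \<le> x\<close> and \<open>y' \<le> x'\<close> hold here,
          each of the two comparisons amounts to equality.\<close>
        moreover have "x = y \<longleftrightarrow> x' = y'"
          using deep_iso_inj[OF assms] x y by auto
        ultimately show ?thesis by force
      qed
    qed
    with x y show "x \<le> y \<longleftrightarrow> the (\<phi> x) \<le> the (\<phi> y)" by simp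
  qed
next
  assume R: "\<forall>x\<in>dom \<phi>. \<forall>y\<in>dom \<phi>. x \<le> y \<longleftrightarrow> the (\<phi> x) \<le> the (\<phi> y)"
  have "x' < y'" if "\<phi> x = Some x'" "\<phi> y = Some y'" "x < y" for x y x' y'
    using R that by (metis domI not_le option.sel)
  then show "order_preserving \<phi>" unfolding order_preserving_def by blast
qed

lemma thompson_F_eq:
  "(thompson_F :: 'a::{finite,linorder} wmap set) = {\<phi> \<in> carrier thompson_G. order_preserving \<phi>}"
  unfolding thompson_F_def using order_preserving_iff by (auto simp: carrier_thompson_G)

lemma order_preserving_ext:
  assumes "deep_iso \<phi>" "order_preserving \<phi>"
  shows "order_preserving (ext \<phi>)"
  unfolding order_preserving_def
proof (intro allI impI)
  fix x y x' y'
  assume *: "ext \<phi> x = Some x'" "ext \<phi> y = Some y'" "x \<parallel> y" "x < y"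
  obtain n where n: "\<And>z. n \<le> length z \<Longrightarrow> \<phi> (x @ z) = Some (x' @ z) \<and> \<phi> (y @ z) = Some (y' @ z)"
    using ext_common_tail[OF *(1,2)] by blast
  let ?z = "replicate n undefined"
  have "x' \<parallel> y'"
    using parallel_image_iff[OF deep_iso_ext[OF assms(1)]] * by blast
  moreover have "x' @ ?z < y' @ ?z"
    using order_preservingD[OF assms(2), of "x @ ?z" _ "y @ ?z"] n[of ?z] *
    by (simp add: parallel_append list_less_append_iff)
  ultimately show "x' < y'" by (simp add: list_less_append_iff)
qed

lemma order_preserving_pinv:
  assumes "deep_iso \<phi>" "order_preserving \<phi>"
  shows "order_preserving (pinv \<phi>)"
  unfolding order_preserving_def pinv_eq_Some[OF assms(1)]
proof (intro allI impI)
  fix x y x' y'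
  assume *: "\<phi> x' = Some x" "\<phi> y' = Some y" "x \<parallel> y" "x < y"
  then have "y' \<parallel> x'"
    using parallel_image_iff[OF assms(1)] parallel_commute by blast
  then have "\<not> y' < x'"
    using order_preservingD[OF assms(2) *(2,1)] *(4) by force
  moreover have "x' \<noteq> y'" using * by auto
  ultimately show "x' < y'" by simp
qed

lemma order_preserving_comp:
  assumes "deep_iso \<phi>" "order_preserving \<psi>" "order_preserving \<phi>"
  shows "order_preserving (\<psi> \<circ>\<^sub>m \<phi>)"
  unfolding order_preserving_def map_comp_Some_iff
  using assms order_preservingD parallel_image_iff by metis

lemma subgroup_thompson_F:
  "subgroup (thompson_F :: 'a::{finite,linorder} wmap set) thompson_G"
  unfolding thompson_F_eq
  by (rule subgroup_thompson_G)
    (auto simp: order_preserving_ext order_preserving_pinv order_preserving_comp,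
     simp add: order_preserving_def)

section \<open>Ternary cyclic order and rotations of sorted lists\<close>

text \<open>The cyclic order induced by a linear order: going upwards from \<open>a\<close> and
  wrapping around at the top, \<open>b\<close> is met strictly before \<open>c\<close>.\<close>

definition cyc :: "'a::linorder \<Rightarrow> 'a \<Rightarrow> 'a \<Rightarrow> bool" where
  "cyc a b c \<longleftrightarrow> a < b \<and> b < c \<or> b < c \<and> c < a \<or> c < a \<and> a < b"

lemma cyc_rotate: "cyc a b c \<Longrightarrow> cyc b c a"
  unfolding cyc_def by blast

lemma cyc_cases:
  assumes "a \<noteq> b" "b \<noteq> c" "a \<noteq> c"
  shows "cyc a b c \<or> cyc a c b"
  using assms unfolding cyc_def by (meson linorder_neqE)

lemma cyc_asym: "cyc a b c \<Longrightarrow> \<not> cyc a c b"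
  unfolding cyc_def by auto

definition cyc_list :: "'a::linorder list \<Rightarrow> bool" where
  "cyc_list xs \<longleftrightarrow> (\<forall>i j k. i < j \<longrightarrow> j < k \<longrightarrow> k < length xs \<longrightarrow> cyc (xs ! i) (xs ! j) (xs ! k))"

lemma cyc_listD: "cyc_list xs \<Longrightarrow> i < j \<Longrightarrow> j < k \<Longrightarrow> k < length xs \<Longrightarrow> cyc (xs ! i) (xs ! j) (xs ! k)"
  unfolding cyc_list_def by blast

lemma cyc_list_rotate1:
  assumes "cyc_list xs"
  shows "cyc_list (rotate1 xs)"
proof (cases xs)
  case (Cons x ys)
  have "cyc ((ys @ [x]) ! i) ((ys @ [x]) ! j) ((ys @ [x]) ! k)"
    if "i < j" "j < k" "k < length (ys @ [x])" for i j k
  proof (cases "k = length ys")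
    case True
    have "cyc x (ys ! i) (ys ! j)"
      using cyc_listD[OF assms, of 0 "Suc i" "Suc j"] that Cons by simp
    with True that show ?thesis by (simp add: nth_append cyc_rotate)
  next
    case False
    then show ?thesis
      using cyc_listD[OF assms, of "Suc i" "Suc j" "Suc k"] that Cons by (simp add: nth_append)
  qed
  with Cons show ?thesis by (simp add: cyc_list_def)
qed (simp add: cyc_list_def)

lemma cyc_list_rotate: "cyc_list xs \<Longrightarrow> cyc_list (rotate n xs)"
  by (induction n) (auto simp: cyc_list_rotate1)

lemma cyc_list_strict_sorted:
  assumes "sorted_wrt (<) xs"
  shows "cyc_list xs"
  unfolding cyc_list_def cyc_def using sorted_wrt_nth_less[OF assms] by force

text \<open>The cyclic condition is invariant under rotation. Once the minimum stands first, the
  condition on the triple of positions 0, \<open>j\<close>, \<open>k\<close> leaves only increasing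
  order at \<open>j\<close> and \<open>k\<close>.\<close>

lemma cyc_list_iff_rotate:
  assumes "distinct xs"
  shows "cyc_list xs \<longleftrightarrow> (\<exists>n. xs = rotate n (sorted_list_of_set (set xs)))"
proof
  assume L: "cyc_list xs"
  show "\<exists>n. xs = rotate n (sorted_list_of_set (set xs))"
  proof (cases "xs = []")
    case False
    then have "Min (set xs) \<in> set xs" by simp
    then obtain m where m: "m < length xs" "xs ! m = Min (set xs)"
      by (auto simp: in_set_conv_nth)
    let ?ys = "rotate m xs"
    have y0: "?ys ! 0 = Min (set xs)"
      using m nth_rotate[of 0 xs m] False by simp
    have "?ys ! j \<le> ?ys ! k" if "j < k" "k < length ?ys" for j k
    proof (cases "j = 0")
      case True
      have "?ys ! k \<in> set xs" using that by (metis nth_mem set_rotate)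
      with True y0 show ?thesis by simp
    next
      case False
      have "?ys ! k \<in> set xs" "?ys ! j \<in> set xs" using that
        by (metis nth_mem set_rotate, metis nth_mem order.strict_trans set_rotate)
      with y0 have "?ys ! 0 \<le> ?ys ! k" "?ys ! 0 \<le> ?ys ! j" by simp_all
      moreover have "cyc (?ys ! 0) (?ys ! j) (?ys ! k)"
        using cyc_listD[OF cyc_list_rotate[OF L]] False that by simp
      ultimately show ?thesis unfolding cyc_def by auto
    qed
    then have "sorted ?ys" by (simp add: sorted_wrt_iff_nth_less)
    then have ys: "?ys = sorted_list_of_set (set xs)"
      using assms by (metis distinct_rotate set_rotate sorted_list_of_set.idem_if_sorted_distinct)
    \<comment> \<open>Undoes the rotation by \<open>m\<close>, since the two amounts add up to the
      length.\<close>
    have "rotate (length xs - m) ?ys = xs"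
      using m by (simp add: rotate_rotate)
    then show ?thesis unfolding ys by metis
  qed simp
next
  assume "\<exists>n. xs = rotate n (sorted_list_of_set (set xs))"
  then obtain n where n: "xs = rotate n (sorted_list_of_set (set xs))" ..
  have "cyc_list (rotate n (sorted_list_of_set (set xs)))"
    by (intro cyc_list_rotate cyc_list_strict_sorted) simp
  with n show "cyc_list xs" by simp
qed

text \<open>The code is necessarily the set of entries, so both existential quantifiers disappear
  and the order condition becomes one on triples.\<close>

lemma cyclical_code_order_iff:
  "cyclical_code_order xs \<longleftrightarrow> distinct xs \<and> cyc_list xs \<and> maximal_prefix_code (set xs)"
proof
  assume "cyclical_code_order xs"
  then obtain P n where *: "finite P" "maximal_prefix_code P" "xs = rotate n (sorted_list_of_set P)"
    unfolding cyclical_code_order_def cyclical_order_def by blast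
  then have xs: "set xs = P" "distinct xs" by simp_all
  have "cyc_list xs"
    unfolding cyc_list_iff_rotate[OF xs(2)] xs(1) using *(3) by (rule exI)
  with xs *(2) show "distinct xs \<and> cyc_list xs \<and> maximal_prefix_code (set xs)" by simp
next
  assume R: "distinct xs \<and> cyc_list xs \<and> maximal_prefix_code (set xs)"
  then have "cyclical_order (set xs) xs"
    unfolding cyclical_order_def using cyc_list_iff_rotate by blast
  with R show "cyclical_code_order xs"
    unfolding cyclical_code_order_def by blast
qed

section \<open>Finite maximal prefix codes\<close>

lemma maximal_prefix_code_iff:
  assumes "finite P"
  shows "maximal_prefix_code P \<longleftrightarrow>
    prefix_code P \<and> (\<exists>n. \<forall>w. n \<le> length w \<longrightarrow> (\<exists>p\<in>P. prefix p w))"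
proof
  assume L: "maximal_prefix_code P"
  then have P: "prefix_code P" unfolding maximal_prefix_code_def by blast
  \<comment> \<open>\<open>insert 0\<close> keeps \<open>Max\<close> meaningful for empty
    \<open>P\<close>, and \<open>Suc\<close> makes \<open>w\<close> longer than every codeword. Were
    no codeword a prefix of \<open>w\<close>, then \<open>w\<close> could be added to the
    code.\<close>
  have "\<exists>p\<in>P. prefix p w" if w: "Suc (Max (insert 0 (length ` P))) \<le> length w" for w
  proof (rule ccontr)
    assume np: "\<not> (\<exists>p\<in>P. prefix p w)"
    have "\<not> prefix w p" if "p \<in> P" for p
    proof
      assume "prefix w p"
      then have "length w \<le> length p" by (rule prefix_length_le)
      moreover have "length p \<le> Max (insert 0 (length ` P))"
        using assms that by simp
      ultimately show False using w by simp
    qed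
    with np P have "prefix_code (insert w P)" by (auto simp: prefix_code_def)
    with L have "w \<in> P" unfolding maximal_prefix_code_def by blast
    with np show False by auto
  qed
  with P show "prefix_code P \<and> (\<exists>n. \<forall>w. n \<le> length w \<longrightarrow> (\<exists>p\<in>P. prefix p w))"
    by blast
next
  assume R: "prefix_code P \<and> (\<exists>n. \<forall>w. n \<le> length w \<longrightarrow> (\<exists>p\<in>P. prefix p w))"
  then obtain n where n: "\<And>w. n \<le> length w \<Longrightarrow> \<exists>p\<in>P. prefix p w" by blast
  have "q \<in> P" if Q: "prefix_code Q" "P \<subseteq> Q" "q \<in> Q" for Q q
  proof -
    obtain p where p: "p \<in> P" "prefix p (q @ replicate n undefined)"
      using n[of "q @ replicate n undefined"] by auto
    then have "prefix p q \<or> prefix q p"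
      using prefixI prefix_same_cases by blast
    then have "p = q" using p Q unfolding prefix_code_def by blast
    with p show ?thesis by simp
  qed
  with R show "maximal_prefix_code P" unfolding maximal_prefix_code_def by blast
qed

lemma finite_words_length: "finite {w :: 'a::finite list. length w = n}"
  using finite_lists_length_eq[of "UNIV :: 'a set" n] by simp

text \<open>Choose \<open>m\<close> at least every length in \<open>Q\<close> and beyond the depth
  bound of \<open>D\<close>, then add all words of length \<open>m\<close> that have no prefix in
  \<open>Q\<close>.\<close>

lemma prefix_code_extend:
  fixes Q :: "'a::finite list set"
  assumes "finite Q" "prefix_code Q" "Q \<subseteq> D" "deep D"
  obtains P where "finite P" "maximal_prefix_code P" "Q \<subseteq> P" "P \<subseteq> D"
proof -
  obtain n where n: "\<And>w. n \<le> length w \<Longrightarrow> w \<in> D"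
    using assms(4) unfolding deep_def by blast
  define m where "m = n + Max (insert 0 (length ` Q))"
  have mQ: "length q \<le> m" if "q \<in> Q" for q
    using assms(1) that unfolding m_def by (simp add: trans_le_add2)
  let ?W = "{w. length w = m \<and> \<not> (\<exists>q\<in>Q. prefix q w)}"
  let ?P = "Q \<union> ?W"
  have fin: "finite ?P"
    using assms(1) finite_words_length[of m] by (auto intro: rev_finite_subset)
  have "x = y" if "x \<in> ?P" "y \<in> ?P" "prefix x y" for x y
  proof (cases "x \<in> Q")
    case True
    with that assms(2) show ?thesis unfolding prefix_code_def by auto
  next
    case False
    then have "length x = m" using that by auto
    moreover have "length y \<le> m" using that mQ by auto
    ultimately show ?thesis
      using prefix_length_le[OF that(3)] that(3) by (auto simp: prefix_def)
  qed
  then have "prefix_code ?P" unfolding prefix_code_def by blast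
  moreover have "\<exists>p\<in>?P. prefix p w" if "m \<le> length w" for w
  proof (cases "take m w \<in> ?P")
    case True
    then show ?thesis using take_is_prefix by blast
  next
    case False
    with that obtain q where "q \<in> Q" "prefix q (take m w)" by auto
    then show ?thesis using take_is_prefix prefix_order.trans by blast
  qed
  ultimately have "maximal_prefix_code ?P"
    using maximal_prefix_code_iff[OF fin] by blast
  moreover have "?P \<subseteq> D" using assms(3) n by (auto simp: m_def)
  ultimately show ?thesis using that fin by blast
qed

text \<open>A long word has a long preimage, which has a prefix in \<open>P\<close>; the image of
  that prefix is a prefix of the given word.\<close>

lemma maximal_prefix_code_image:
  assumes "deep_iso \<phi>" "finite P" "P \<subseteq> dom \<phi>" "maximal_prefix_code P"
  shows "maximal_prefix_code ((\<lambda>x. the (\<phi> x)) ` P)"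
proof -
  have fin: "finite ((\<lambda>x. the (\<phi> x)) ` P)" using assms(2) by simp
  obtain n where P: "prefix_code P" and n: "\<And>w. n \<le> length w \<Longrightarrow> \<exists>p\<in>P. prefix p w"
    using assms(4) maximal_prefix_code_iff[OF assms(2)] by blast
  have "prefix_code ((\<lambda>x. the (\<phi> x)) ` P)"
    unfolding prefix_code_def
  proof (intro ballI impI)
    fix x' y' assume "x' \<in> (\<lambda>x. the (\<phi> x)) ` P" "y' \<in> (\<lambda>x. the (\<phi> x)) ` P" "prefix x' y'"
    moreover from this obtain x y where "x \<in> P" "y \<in> P" "\<phi> x = Some x'" "\<phi> y = Some y'"
      using assms(3) by force
    ultimately have "x = y"
      using prefix_image_iff[OF assms(1)] P unfolding prefix_code_def by blast
    then show "x' = y'" using \<open>\<phi> x = Some x'\<close> \<open>\<phi> y = Some y'\<close> by simp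
  qed
  moreover obtain m where m: "\<And>w. m \<le> length w \<Longrightarrow> \<exists>y. pinv \<phi> w = Some y \<and> n \<le> length y"
    using deep_iso_proper[OF deep_iso_pinv[OF assms(1)]] by blast
  have "\<exists>p\<in>(\<lambda>x. the (\<phi> x)) ` P. prefix p w" if w: "m \<le> length w" for w
  proof -
    obtain x where x: "\<phi> x = Some w" "n \<le> length x"
      using m[OF w] pinv_eq_Some[OF assms(1)] by blast
    then obtain p where p: "p \<in> P" "prefix p x" using n by blast
    moreover from p obtain p' where "\<phi> p = Some p'" using assms(3) by blast
    ultimately have "prefix p' w" "p' \<in> (\<lambda>x. the (\<phi> x)) ` P"
      using prefix_image_iff[OF assms(1) _ x(1)] by force+
    then show ?thesis by blast
  qed
  ultimately show ?thesis using maximal_prefix_code_iff[OF fin] by blast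
qed

section \<open>The group T through cyclic order on triples\<close>

definition cyc_preserving :: "'a::linorder wmap \<Rightarrow> bool" where
  "cyc_preserving \<phi> \<longleftrightarrow>
     (\<forall>x y z x' y' z'. \<phi> x = Some x' \<longrightarrow> \<phi> y = Some y' \<longrightarrow> \<phi> z = Some z' \<longrightarrow>
        x \<parallel> y \<longrightarrow> y \<parallel> z \<longrightarrow> x \<parallel> z \<longrightarrow> cyc x y z \<longrightarrow> cyc x' y' z')"

lemma cyc_preservingD:
  "cyc_preserving \<phi> \<Longrightarrow> \<phi> x = Some x' \<Longrightarrow> \<phi> y = Some y' \<Longrightarrow> \<phi> z = Some z' \<Longrightarrow>
   x \<parallel> y \<Longrightarrow> y \<parallel> z \<Longrightarrow> x \<parallel> z \<Longrightarrow> cyc x y z \<Longrightarrow> cyc x' y' z'"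
  unfolding cyc_preserving_def by blast

lemma cyc_append_iff:
  assumes "x \<parallel> y" "y \<parallel> z" "x \<parallel> z"
  shows "cyc (x @ u) (y @ u) (z @ u) \<longleftrightarrow> cyc x y z"
proof -
  have "z \<parallel> x" using assms by (simp add: parallel_commute)
  with assms show ?thesis by (simp add: cyc_def list_less_append_iff)
qed

lemma cyc_preserving_ext:
  assumes "deep_iso \<phi>" "cyc_preserving \<phi>"
  shows "cyc_preserving (ext \<phi>)"
  unfolding cyc_preserving_def
proof (intro allI impI)
  fix x y z x' y' z'
  assume *: "ext \<phi> x = Some x'" "ext \<phi> y = Some y'" "ext \<phi> z = Some z'"
    "x \<parallel> y" "y \<parallel> z" "x \<parallel> z" "cyc x y z"
  obtain n m where
    "\<And>u. n \<le> length u \<Longrightarrow> \<phi> (x @ u) = Some (x' @ u) \<and> \<phi> (y @ u) = Some (y' @ u)"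
    "\<And>u. m \<le> length u \<Longrightarrow> \<phi> (y @ u) = Some (y' @ u) \<and> \<phi> (z @ u) = Some (z' @ u)"
    using ext_common_tail[OF *(1,2)] ext_common_tail[OF *(2,3)] by metis
  moreover define u where "u = replicate (n + m) (undefined :: 'a)"
  ultimately have u: "\<phi> (x @ u) = Some (x' @ u)" "\<phi> (y @ u) = Some (y' @ u)"
    "\<phi> (z @ u) = Some (z' @ u)" by simp_all
  have p: "x' \<parallel> y'" "y' \<parallel> z'" "x' \<parallel> z'"
    using parallel_image_iff[OF deep_iso_ext[OF assms(1)]] * by blast+
  have "cyc (x' @ u) (y' @ u) (z' @ u)"
    using cyc_preservingD[OF assms(2) u] * by (simp add: parallel_append cyc_append_iff)
  with p show "cyc x' y' z'" by (simp add: cyc_append_iff)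
qed

text \<open>Three distinct words have exactly one of the two cyclic orientations. If the preimages
  had the opposite one, \<phi> would carry it over to the images.\<close>

lemma cyc_preserving_pinv:
  assumes "deep_iso \<phi>" "cyc_preserving \<phi>"
  shows "cyc_preserving (pinv \<phi>)"
  unfolding cyc_preserving_def pinv_eq_Some[OF assms(1)]
proof (intro allI impI)
  fix x y z x' y' z'
  assume *: "\<phi> x' = Some x" "\<phi> y' = Some y" "\<phi> z' = Some z"
    "x \<parallel> y" "y \<parallel> z" "x \<parallel> z" "cyc x y z"
  have p: "x' \<parallel> y'" "y' \<parallel> z'" "z' \<parallel> y'" "x' \<parallel> z'"
    using * parallel_image_iff[OF assms(1)] parallel_commute by blast+
  have "\<not> cyc x' z' y'"
    using cyc_preservingD[OF assms(2) *(1,3,2)] p cyc_asym[OF *(7)] by blast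
  moreover have "x' \<noteq> y'" "y' \<noteq> z'" "x' \<noteq> z'" using p by (auto simp: parallel_def)
  ultimately show "cyc x' y' z'" using cyc_cases by blast
qed

lemma cyc_preserving_comp:
  assumes "deep_iso \<phi>" "cyc_preserving \<psi>" "cyc_preserving \<phi>"
  shows "cyc_preserving (\<psi> \<circ>\<^sub>m \<phi>)"
  unfolding cyc_preserving_def
proof (intro allI impI)
  fix x y z x' y' z'
  assume *: "(\<psi> \<circ>\<^sub>m \<phi>) x = Some x'" "(\<psi> \<circ>\<^sub>m \<phi>) y = Some y'" "(\<psi> \<circ>\<^sub>m \<phi>) z = Some z'"
    "x \<parallel> y" "y \<parallel> z" "x \<parallel> z" "cyc x y z"
  then obtain a b c where a: "\<phi> x = Some a" "\<phi> y = Some b" "\<phi> z = Some c"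
    and b: "\<psi> a = Some x'" "\<psi> b = Some y'" "\<psi> c = Some z'"
    by (auto simp: map_comp_Some_iff)
  have "a \<parallel> b" "b \<parallel> c" "a \<parallel> c"
    using * a parallel_image_iff[OF assms(1)] by blast+
  then show "cyc x' y' z'"
    using cyc_preservingD[OF assms(2) b] cyc_preservingD[OF assms(3) a] * by blast
qed

lemma order_preserving_imp_cyc_preserving:
  assumes "order_preserving \<phi>"
  shows "cyc_preserving \<phi>"
  unfolding cyc_preserving_def
proof (intro allI impI)
  fix x y z x' y' z'
  assume *: "\<phi> x = Some x'" "\<phi> y = Some y'" "\<phi> z = Some z'"
    "x \<parallel> y" "y \<parallel> z" "x \<parallel> z" "cyc x y z"
  then have "z \<parallel> x" by (simp add: parallel_commute)
  then have "x < y \<Longrightarrow> x' < y'" "y < z \<Longrightarrow> y' < z'" "z < x \<Longrightarrow> z' < x'"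
    using order_preservingD[OF assms] * by blast+
  with *(7) show "cyc x' y' z'" unfolding cyc_def by blast
qed

lemma cyclical_code_order_map:
  assumes "deep_iso \<phi>" "cyc_preserving \<phi>" "set xs \<subseteq> dom \<phi>" "cyclical_code_order xs"
  shows "cyclical_code_order (map (\<lambda>x. the (\<phi> x)) xs)"
proof -
  have xs: "distinct xs" "cyc_list xs" "maximal_prefix_code (set xs)"
    using assms(4) cyclical_code_order_iff by blast+
  have some: "\<phi> (xs ! i) = Some (the (\<phi> (xs ! i)))" if "i < length xs" for i
    using assms(3) that nth_mem by fastforce
  have par: "xs ! i \<parallel> xs ! j" if "i < j" "j < length xs" for i j
  proof -
    have "xs ! i \<noteq> xs ! j" using xs(1) that by (simp add: nth_eq_iff_index_eq)
    moreover have "prefix_code (set xs)"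
      using xs(3) unfolding maximal_prefix_code_def by blast
    moreover have "xs ! i \<in> set xs" "xs ! j \<in> set xs" using that by simp_all
    ultimately show ?thesis unfolding prefix_code_def parallel_def by metis
  qed
  have "inj_on (\<lambda>x. the (\<phi> x)) (set xs)"
    using assms(3) deep_iso_inj[OF assms(1)] by (intro inj_onI) (metis domD option.sel subsetD)
  then have "distinct (map (\<lambda>x. the (\<phi> x)) xs)"
    using xs(1) by (simp add: distinct_map)
  moreover have "cyc_list (map (\<lambda>x. the (\<phi> x)) xs)"
    unfolding cyc_list_def
  proof (intro allI impI)
    fix i j k assume ijk: "i < j" "j < k" "k < length (map (\<lambda>x. the (\<phi> x)) xs)"
    then have "cyc (the (\<phi> (xs ! i))) (the (\<phi> (xs ! j))) (the (\<phi> (xs ! k)))"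
      by (intro cyc_preservingD[OF assms(2) some some some] par cyc_listD[OF xs(2)]) simp_all
    with ijk show "cyc (map (\<lambda>x. the (\<phi> x)) xs ! i) (map (\<lambda>x. the (\<phi> x)) xs ! j)
        (map (\<lambda>x. the (\<phi> x)) xs ! k)" by simp
  qed
  moreover have "maximal_prefix_code (set (map (\<lambda>x. the (\<phi> x)) xs))"
    using maximal_prefix_code_image[OF assms(1) _ assms(3) xs(3)] by simp
  ultimately show ?thesis using cyclical_code_order_iff by blast
qed

text \<open>For the converse, a pairwise incomparable triple is completed to a finite maximal prefix
  code inside the domain, and the hypothesis is applied to its sorted listing. Forwards, the reverse
  implication for listings comes from applying \<open>cyclical_code_order_map\<close> to
  \<open>pinv \<phi>\<close>.\<close>

lemma cyc_preserving_iff: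
  fixes \<phi> :: "'a::{finite,linorder} wmap"
  assumes "deep_iso \<phi>"
  shows "cyc_preserving \<phi> \<longleftrightarrow>
    (\<forall>xs. set xs \<subseteq> dom \<phi> \<longrightarrow>
      (cyclical_code_order xs \<longleftrightarrow> cyclical_code_order (map (\<lambda>x. the (\<phi> x)) xs)))"
proof
  assume L: "cyc_preserving \<phi>"
  show "\<forall>xs. set xs \<subseteq> dom \<phi> \<longrightarrow>
      (cyclical_code_order xs \<longleftrightarrow> cyclical_code_order (map (\<lambda>x. the (\<phi> x)) xs))"
  proof (intro allI impI iffI)
    fix xs assume xs: "set xs \<subseteq> dom \<phi>"
    show "cyclical_code_order (map (\<lambda>x. the (\<phi> x)) xs)" if "cyclical_code_order xs"
      using cyclical_code_order_map[OF assms L xs that] .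
    assume C: "cyclical_code_order (map (\<lambda>x. the (\<phi> x)) xs)"
    have inv: "pinv \<phi> (the (\<phi> x)) = Some x" if "x \<in> set xs" for x
      using xs that pinv_eq_Some[OF assms] by force
    then have "set (map (\<lambda>x. the (\<phi> x)) xs) \<subseteq> dom (pinv \<phi>)" by auto
    from cyclical_code_order_map[OF deep_iso_pinv[OF assms] cyc_preserving_pinv[OF assms L] this C]
    have "cyclical_code_order (map (\<lambda>x. the (pinv \<phi> (the (\<phi> x)))) xs)"
      by (simp add: comp_def)
    also have "map (\<lambda>x. the (pinv \<phi> (the (\<phi> x)))) xs = xs"
      using inv by (simp add: map_idI)
    finally show "cyclical_code_order xs" .
  qed
next
  assume R: "\<forall>xs. set xs \<subseteq> dom \<phi> \<longrightarrow>
      (cyclical_code_order xs \<longleftrightarrow> cyclical_code_order (map (\<lambda>x. the (\<phi> x)) xs))"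
  \<comment> \<open>Only increasing triples are treated here; each case of \<open>cyc\<close> is a
    rotation of one.\<close>
  have I: "cyc x' y' z'"
    if *: "\<phi> x = Some x'" "\<phi> y = Some y'" "\<phi> z = Some z'" "x \<parallel> y" "y \<parallel> z" "x \<parallel> z" "x < y" "y < z"
    for x y z x' y' z'
  proof -
    have "prefix_code {x, y, z}" "{x, y, z} \<subseteq> dom \<phi>"
      using * by (auto simp: prefix_code_def parallel_def)
    then obtain P where P: "finite P" "maximal_prefix_code P" "{x, y, z} \<subseteq> P" "P \<subseteq> dom \<phi>"
      using prefix_code_extend[OF _ _ _ deep_iso_dom[OF assms]] by (metis finite.emptyI finite_insert)
    define xs where "xs = sorted_list_of_set P"
    have set: "set xs = P" and sorted: "sorted_wrt (<) xs"
      using P(1) by (simp_all add: xs_def)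
    have "cyclical_code_order xs"
      using P(2) set sorted cyc_list_strict_sorted
      by (auto simp: cyclical_code_order_iff strict_sorted_iff)
    with R set P(4) have "cyclical_code_order (map (\<lambda>x. the (\<phi> x)) xs)" by blast
    then have C: "cyc_list (map (\<lambda>x. the (\<phi> x)) xs)" by (simp add: cyclical_code_order_iff)
    obtain i j k where ijk: "i < length xs" "xs ! i = x" "j < length xs" "xs ! j = y"
      "k < length xs" "xs ! k = z"
      using P(3) set by (auto simp: in_set_conv_nth)
    have "a < b" if "xs ! a < xs ! b" "a < length xs" for a b
      using sorted_wrt_nth_less[OF sorted, of b a] that by (cases a b rule: linorder_cases) auto
    then have "i < j" "j < k" using ijk *(7,8) by blast+
    from cyc_listD[OF C this] ijk *(1-3) show ?thesis by simp
  qed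
  show "cyc_preserving \<phi>"
    unfolding cyc_preserving_def
  proof (intro allI impI)
    fix x y z x' y' z'
    assume *: "\<phi> x = Some x'" "\<phi> y = Some y'" "\<phi> z = Some z'"
      "x \<parallel> y" "y \<parallel> z" "x \<parallel> z" "cyc x y z"
    then have "z \<parallel> x" "y \<parallel> x" "z \<parallel> y" by (simp_all add: parallel_commute)
    with * show "cyc x' y' z'"
      using I[OF *(1,2,3)] I[OF *(2,3,1)] I[OF *(3,1,2)] cyc_rotate unfolding cyc_def by metis
  qed
qed

lemma thompson_T_eq:
  "(thompson_T :: 'a::{finite,linorder} wmap set) = {\<phi> \<in> carrier thompson_G. cyc_preserving \<phi>}"
  unfolding thompson_T_def using cyc_preserving_iff by (auto simp: carrier_thompson_G)

lemma subgroup_thompson_T: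
  "subgroup (thompson_T :: 'a::{finite,linorder} wmap set) thompson_G"
  unfolding thompson_T_eq
  by (rule subgroup_thompson_G)
    (auto simp: cyc_preserving_ext cyc_preserving_pinv cyc_preserving_comp,
     simp add: cyc_preserving_def)

lemma thompson_F_subset_T:
  "(thompson_F :: 'a::{finite,linorder} wmap set) \<subseteq> thompson_T"
  by (auto simp: thompson_F_eq thompson_T_eq order_preserving_imp_cyc_preserving)

section \<open>The factorization\<close>

definition length_preserving :: "'a wmap \<Rightarrow> bool" where
  "length_preserving \<phi> \<longleftrightarrow> (\<forall>x y. \<phi> x = Some y \<longrightarrow> length y = length x)"

lemma lp_G_eq: "lp_G = {\<phi> \<in> carrier thompson_G. length_preserving \<phi>}"
  unfolding lp_G_def length_preserving_def by (force simp: dom_def)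

lemma length_preserving_ext: "length_preserving \<phi> \<Longrightarrow> length_preserving (ext \<phi>)"
  unfolding length_preserving_def
proof (intro allI impI)
  fix x y assume \<phi>: "\<forall>x y. \<phi> x = Some y \<longrightarrow> length y = length x" and "ext \<phi> x = Some y"
  then obtain n where "\<And>z. n \<le> length z \<Longrightarrow> \<phi> (x @ z) = Some (y @ z)"
    unfolding ext_eq_Some ext_rel_def by blast
  then have "\<phi> (x @ replicate n undefined) = Some (y @ replicate n undefined)" by simp
  with \<phi> show "length y = length x" by fastforce
qed

lemma subgroup_lp_G: "subgroup (lp_G :: 'a::finite wmap set) thompson_G"
  unfolding lp_G_eq
  by (rule subgroup_thompson_G)
    (auto simp: length_preserving_ext,
     auto simp: length_preserving_def pinv_eq_Some map_comp_Some_iff)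

text \<open>On the words of each sufficiently large length such an element is a strictly monotone
  permutation. It fixes the unique sorted listing, so it is eventually the identity, and maximality
  does the rest.\<close>

lemma lp_G_Int_thompson_F:
  "lp_G \<inter> (thompson_F :: 'a::{finite,linorder} wmap set) = {\<one>\<^bsub>thompson_G\<^esub>}"
proof -
  interpret group "thompson_G :: 'a wmap monoid" by (rule group_thompson_G)
  have "\<phi> = Some" if \<phi>: "\<phi> \<in> lp_G" "\<phi> \<in> thompson_F" for \<phi> :: "'a wmap"
  proof -
    have d: "deep_iso \<phi>" "ext \<phi> = \<phi>" and lp: "length_preserving \<phi>" and op: "order_preserving \<phi>"
      using \<phi> by (auto simp: lp_G_eq thompson_F_eq carrier_thompson_G)
    obtain n where n: "\<And>w. n \<le> length w \<Longrightarrow> w \<in> dom \<phi>"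
      using deep_iso_dom[OF d(1)] unfolding deep_def by blast
    have "\<phi> w = Some w" if w: "n \<le> length w" for w
    proof -
      let ?W = "{v :: 'a list. length v = length w}" and ?g = "\<lambda>x. the (\<phi> x)"
      define xs where "xs = sorted_list_of_set ?W"
      have set: "set xs = ?W" and sorted: "sorted_wrt (<) xs"
        by (simp_all add: xs_def finite_words_length)
      have g: "\<phi> v = Some (?g v)" if "v \<in> ?W" for v
        using n[of v] that w by auto
      have mono: "?g u < ?g v" if "u \<in> ?W" "v \<in> ?W" "u < v" for u v
      proof -
        have "u \<parallel> v" using that by (intro not_equal_is_parallel) auto
        then show ?thesis using order_preservingD[OF op g[OF that(1)] g[OF that(2)]] that by blast
      qed
      have "?g ` ?W \<subseteq> ?W" using g lp unfolding length_preserving_def by fastforce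
      moreover have "inj_on ?g ?W" by (intro strict_mono_on_imp_inj_on strict_mono_onI mono)
      ultimately have surj: "?g ` ?W = ?W" using endo_inj_surj finite_words_length by blast
      have "sorted_wrt (<) (map ?g xs)"
        unfolding sorted_wrt_map
        by (rule sorted_wrt_mono_rel[OF _ sorted]) (use mono set in auto)
      moreover have "set (map ?g xs) = set xs" using set surj by simp
      ultimately have "map ?g xs = xs" using sorted strict_sorted_equal by blast
      then have "map ?g xs = map (\<lambda>v. v) xs" by simp
      then have "?g w = w" unfolding map_eq_conv set by simp
      with g[of w] show ?thesis by simp
    qed
    then have "agree \<phi> Some" unfolding agree_def by blast
    then show ?thesis using ext_cong d(2) ext_Some by metis
  qed
  moreover have "\<one>\<^bsub>thompson_G\<^esub> \<in> lp_G \<inter> (thompson_F :: 'a wmap set)"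
    using subgroup.one_closed subgroup_lp_G subgroup_thompson_F by blast
  ultimately show ?thesis unfolding one_thompson_G by blast
qed

text \<open>An element with \<open>r\<close> smaller elements in \<open>A\<close> goes to the entry
  at index \<open>r\<close> of the sorted listing of \<open>B\<close>.\<close>

lemma ex_strict_mono_bij:
  fixes A :: "'a::linorder set" and B :: "'b::linorder set"
  assumes "finite A" "finite B" "card A = card B"
  obtains h where "bij_betw h A B" "strict_mono_on A h"
proof -
  define ys where "ys = sorted_list_of_set B"
  have ys: "set ys = B" "sorted_wrt (<) ys" "length ys = card A"
    using assms by (simp_all add: ys_def)
  define r where "r x = card {a \<in> A. a < x}" for x
  have r: "r x < card A" if "x \<in> A" for x
    unfolding r_def using assms(1) that by (intro psubset_card_mono) auto
  have "r x < r y" if "x \<in> A" "x < y" for x y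
    unfolding r_def using assms(1) that by (intro psubset_card_mono) auto
  then have mono: "strict_mono_on A (\<lambda>x. ys ! r x)"
    using sorted_wrt_nth_less[OF ys(2)] r ys(3) by (simp add: strict_mono_on_def)
  then have inj: "inj_on (\<lambda>x. ys ! r x) A"
    by (rule strict_mono_on_imp_inj_on)
  have "(\<lambda>x. ys ! r x) ` A \<subseteq> B"
    using r ys nth_mem by fastforce
  then have "(\<lambda>x. ys ! r x) ` A = B"
    using assms inj by (intro card_subset_eq) (simp_all add: card_image)
  with inj mono show ?thesis
    using that[of "\<lambda>x. ys ! r x"] unfolding bij_betw_def by blast
qed

text \<open>For a permutation \<tau> of the words of length \<open>n\<close>, this is the induced
  isomorphism of the ideal they generate. It need not be maximally extended, so \<open>ext\<close>
  is applied before it is used as a group element.\<close>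

definition prefix_perm :: "nat \<Rightarrow> ('a list \<Rightarrow> 'a list) \<Rightarrow> 'a wmap" where
  "prefix_perm n \<tau> w = (if n \<le> length w then Some (\<tau> (take n w) @ drop n w) else None)"

lemma deep_iso_prefix_perm:
  assumes "bij_betw \<tau> {w. length w = n} {w. length w = n}"
  shows "deep_iso (prefix_perm n \<tau>)"
proof -
  have len: "length (\<tau> (take n w)) = n" if "n \<le> length w" for w
    using bij_betwE[OF assms] that by simp
  have "x = x'" if "prefix_perm n \<tau> x = Some y" "prefix_perm n \<tau> x' = Some y" for x x' y
  proof -
    have l: "n \<le> length x" "n \<le> length x'" and
      eq: "\<tau> (take n x) @ drop n x = \<tau> (take n x') @ drop n x'"
      using that by (auto simp: prefix_perm_def split: if_splits)
    then have "\<tau> (take n x) = \<tau> (take n x')" and dr: "drop n x = drop n x'"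
      using len by auto
    then have "take n x = take n x'"
      using bij_betw_imp_inj_on[OF assms] l by (auto dest: inj_onD)
    with dr show ?thesis by (metis append_take_drop_id)
  qed
  moreover have "w \<in> ran (prefix_perm n \<tau>)" if "n \<le> length w" for w
  proof -
    have "take n w \<in> \<tau> ` {w. length w = n}"
      using bij_betw_imp_surj_on[OF assms] that by simp
    then obtain v where "length v = n" "\<tau> v = take n w" by auto
    then have "prefix_perm n \<tau> (v @ drop n w) = Some w"
      by (simp add: prefix_perm_def)
    then show ?thesis by (rule ranI)
  qed
  then have "deep (ran (prefix_perm n \<tau>))" unfolding deep_def by blast
  moreover have "deep (dom (prefix_perm n \<tau>))"
    unfolding deep_def by (auto simp: prefix_perm_def)
  moreover have "prefix_perm n \<tau> (x @ z) = Some (y @ z)"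
    if "prefix_perm n \<tau> x = Some y" for x y z
    using that by (auto simp: prefix_perm_def split: if_splits)
  ultimately show ?thesis
    unfolding deep_iso_def by blast
qed

lemma length_preserving_prefix_perm:
  assumes "bij_betw \<tau> {w. length w = n} {w. length w = n}"
  shows "length_preserving (prefix_perm n \<tau>)"
  using bij_betwE[OF assms] by (auto simp: length_preserving_def prefix_perm_def)

lemma ex_prefix_perm_order_preserving:
  fixes \<phi> :: "'a::{finite,linorder} wmap"
  assumes "deep_iso \<phi>"
  obtains n \<tau> where "bij_betw \<tau> {w. length w = n} {w. length w = n}"
    "order_preserving (prefix_perm n \<tau> \<circ>\<^sub>m \<phi>)"
proof -
  obtain n where n: "\<And>w. n \<le> length w \<Longrightarrow> \<exists>x. \<phi> x = Some w"
    using assms unfolding deep_iso_def deep_def ran_def by blast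
  let ?W = "{w :: 'a list. length w = n}"
  define g where "g w = the (pinv \<phi> w)" for w
  have g: "\<phi> (g w) = Some w" if "n \<le> length w" for w
  proof -
    obtain x where x: "\<phi> x = Some w" using n \<open>n \<le> length w\<close> by blast
    then have "pinv \<phi> w = Some x" by (simp add: pinv_eq_Some[OF assms])
    with x show ?thesis by (simp add: g_def)
  qed
  have inj: "inj_on g ?W" using g by (intro inj_onI) (metis mem_Collect_eq option.inject order_refl)
  obtain h where h: "bij_betw h (g ` ?W) ?W"
    and mono: "strict_mono_on (g ` ?W) h"
    by (rule ex_strict_mono_bij[OF finite_imageI[OF finite_words_length] finite_words_length
          card_image[OF inj]])
  have bij: "bij_betw (h \<circ> g) ?W ?W"
    using bij_betw_trans[OF inj_on_imp_bij_betw[OF inj] h] .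
  \<comment> \<open>Every word in the domain of the composite extends some \<open>g q\<close>, and
    the remaining tail is copied.\<close>
  have D: "\<exists>q u. length q = n \<and> x = g q @ u \<and> y = h (g q) @ u"
    if "(prefix_perm n (h \<circ> g) \<circ>\<^sub>m \<phi>) x = Some y" for x y
  proof -
    from that obtain w where w: "\<phi> x = Some w" "n \<le> length w"
      and y: "y = h (g (take n w)) @ drop n w"
      by (auto simp: map_comp_Some_iff prefix_perm_def split: if_splits)
    have "\<phi> (g (take n w) @ drop n w) = Some w"
      using deep_iso_append[OF assms g, of "take n w" "drop n w"] w(2) by simp
    then have "x = g (take n w) @ drop n w"
      using deep_iso_inj[OF assms w(1)] by blast
    with y w(2) show ?thesis by (metis length_take min.absorb2)
  qed
  have "x' < y'"
    if *: "(prefix_perm n (h \<circ> g) \<circ>\<^sub>m \<phi>) x = Some x'"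
      "(prefix_perm n (h \<circ> g) \<circ>\<^sub>m \<phi>) y = Some y'" "x < y" for x y x' y'
  proof -
    obtain p u where p: "length p = n" "x = g p @ u" "x' = h (g p) @ u"
      using D[OF *(1)] by blast
    obtain q v where q: "length q = n" "y = g q @ v" "y' = h (g q) @ v"
      using D[OF *(2)] by blast
    \<comment> \<open>With a common codeword the tails decide the comparison; distinct codewords are
      incomparable, as are their images, so monotonicity of \<open>h\<close> decides it.\<close>
    show ?thesis
    proof (cases "p = q")
      case True
      with p q *(3) show ?thesis by (simp add: list_less_append_cancel)
    next
      case False
      then have "p \<parallel> q" using p(1) q(1) by (intro not_equal_is_parallel) auto
      then have "g p \<parallel> g q"
        using parallel_image_iff[OF assms g g, of p q] p(1) q(1) by simp
      then have lt: "g p < g q" using *(3) p(2) q(2) by (simp add: list_less_append_iff)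
      then have lt': "h (g p) < h (g q)" using strict_mono_onD[OF mono] p(1) q(1) by simp
      have "length (h (g p)) = n" "length (h (g q)) = n"
        using bij_betwE[OF bij] p(1) q(1) by simp_all
      then have "h (g p) \<parallel> h (g q)"
        using lt' by (intro not_equal_is_parallel) auto
      with lt' p(3) q(3) show ?thesis by (simp add: list_less_append_iff)
    qed
  qed
  then have "order_preserving (prefix_perm n (h \<circ> g) \<circ>\<^sub>m \<phi>)"
    unfolding order_preserving_def by blast
  with bij show ?thesis using that by blast
qed

lemma carrier_eq_lp_G_mult_thompson_F:
  "carrier thompson_G = lp_G <#>\<^bsub>thompson_G\<^esub> (thompson_F :: 'a::{finite,linorder} wmap set)"
proof
  interpret group "thompson_G :: 'a wmap monoid" by (rule group_thompson_G)
  show "lp_G <#>\<^bsub>thompson_G\<^esub> (thompson_F :: 'a wmap set) \<subseteq> carrier thompson_G"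
    using subgroup.subset subgroup_lp_G subgroup_thompson_F set_mult_closed by metis
  show "carrier thompson_G \<subseteq> lp_G <#>\<^bsub>thompson_G\<^esub> (thompson_F :: 'a wmap set)"
  proof
    fix \<phi> :: "'a wmap" assume \<phi>: "\<phi> \<in> carrier thompson_G"
    then have d: "deep_iso \<phi>" by (simp add: carrier_thompson_G)
    obtain n \<tau> where bij: "bij_betw \<tau> {w :: 'a list. length w = n} {w. length w = n}"
      and op: "order_preserving (prefix_perm n \<tau> \<circ>\<^sub>m \<phi>)"
      using ex_prefix_perm_order_preserving[OF d] by blast
    define \<omega> where "\<omega> = prefix_perm n \<tau>"
    have \<omega>: "deep_iso \<omega>" "length_preserving \<omega>"
      using deep_iso_prefix_perm length_preserving_prefix_perm bij by (auto simp: \<omega>_def)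
    then have lp: "ext \<omega> \<in> lp_G"
      by (simp add: lp_G_eq carrier_thompson_G deep_iso_ext ext_idem length_preserving_ext)
    then have c: "ext \<omega> \<in> carrier thompson_G" by (simp add: lp_G_eq)
    let ?f = "ext \<omega> \<otimes>\<^bsub>thompson_G\<^esub> \<phi>"
    have "?f = ext (\<omega> \<circ>\<^sub>m \<phi>)"
      using \<omega> d by (simp add: mult_thompson_G deep_iso_ext ext_cong agree_comp_right agree_ext)
    then have "?f \<in> thompson_F"
      using op \<omega>(1) d
      by (simp add: thompson_F_eq carrier_thompson_G deep_iso_comp deep_iso_ext ext_idem
          order_preserving_ext \<omega>_def)
    moreover have "inv\<^bsub>thompson_G\<^esub> (ext \<omega>) \<in> lp_G"
      using subgroup.m_inv_closed[OF subgroup_lp_G lp] .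
    \<comment> \<open>The permutation straightens \<phi> from the left, so its inverse is the
      length-preserving factor.\<close>
    moreover have "\<phi> = inv\<^bsub>thompson_G\<^esub> (ext \<omega>) \<otimes>\<^bsub>thompson_G\<^esub> ?f"
      using \<phi> c by (simp add: m_assoc[symmetric])
    ultimately show "\<phi> \<in> lp_G <#>\<^bsub>thompson_G\<^esub> thompson_F"
      unfolding set_mult_def by blast
  qed
qed

section \<open>Products of two subgroups and the final assembly\<close>

text \<open>Inverting a factorization of \<open>inv s\<close> swaps the factors. Conversely both
  subgroups lie in \<open>S\<close>, as each contains the identity.\<close>

lemma (in group) set_mult_commute_if_subgroup:
  assumes "subgroup S G" "subgroup X G" "subgroup Y G" "S = X <#> Y"
  shows "S = Y <#> X"
proof (intro equalityI subsetI)
  fix s assume s: "s \<in> S"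
  then have "inv s \<in> X <#> Y" using assms subgroup.m_inv_closed by metis
  then obtain x y where xy: "x \<in> X" "y \<in> Y" "inv s = x \<otimes> y" unfolding set_mult_def by blast
  then have c: "x \<in> carrier G" "y \<in> carrier G" "s \<in> carrier G"
    using assms s subgroup.mem_carrier by metis+
  then have "s = inv y \<otimes> inv x" using xy(3) by (metis inv_inv inv_mult_group)
  moreover have "inv y \<in> Y" "inv x \<in> X"
    using xy(1,2) assms(2,3) by (simp_all add: subgroup.m_inv_closed)
  ultimately show "s \<in> Y <#> X"
    unfolding set_mult_def by blast
next
  fix s assume "s \<in> Y <#> X"
  then obtain x y where xy: "x \<in> X" "y \<in> Y" "s = y \<otimes> x" unfolding set_mult_def by blast
  have "x \<otimes> \<one> \<in> S" "\<one> \<otimes> y \<in> S"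
    using xy(1,2) subgroup.one_closed[OF assms(2)] subgroup.one_closed[OF assms(3)]
    unfolding assms(4) set_mult_def by blast+
  then have "x \<in> S" "y \<in> S"
    using xy(1,2) subgroup.mem_carrier[OF assms(2)] subgroup.mem_carrier[OF assms(3)] by simp_all
  then show "s \<in> S" using xy assms(1) subgroup.m_closed by metis
qed

text \<open>Two factorizations give \<open>inv x' \<otimes> x = y' \<otimes> inv y\<close>, an
  element of both subgroups and hence the identity.\<close>

lemma (in group) set_mult_unique_factors:
  assumes "subgroup X G" "subgroup Y G" "X \<inter> Y = {\<one>}"
    and "x \<in> X" "x' \<in> X" "y \<in> Y" "y' \<in> Y" "x \<otimes> y = x' \<otimes> y'"
  shows "x = x' \<and> y = y'"
proof -
  have c: "x \<in> carrier G" "x' \<in> carrier G" "y \<in> carrier G" "y' \<in> carrier G"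
    using assms subgroup.mem_carrier by metis+
  have "inv x' \<otimes> x = y' \<otimes> inv y"
    using c assms(8) by (metis inv_closed inv_solve_left inv_solve_right m_assoc m_closed)
  moreover have "inv x' \<otimes> x \<in> X" "y' \<otimes> inv y \<in> Y"
    using assms by (simp_all add: subgroup.m_closed subgroup.m_inv_closed)
  ultimately have "inv x' \<otimes> x = \<one>" using assms(3) by auto
  then have "x = x'" using c by (metis inv_closed inv_equality inv_inv)
  then show ?thesis using c assms(8) by simp
qed

lemma unique_factorization_if_trivial_Int:
  fixes S X Y :: "'a::finite wmap set"
  assumes "subgroup X thompson_G" "subgroup Y thompson_G" "X \<inter> Y = {\<one>\<^bsub>thompson_G\<^esub>}"
    and S: "S = X <#>\<^bsub>thompson_G\<^esub> Y"
  shows "unique_factorization S X Y"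
  unfolding unique_factorization_def
proof
  interpret group "thompson_G :: 'a wmap monoid" by (rule group_thompson_G)
  fix \<phi> assume "\<phi> \<in> S"
  then obtain \<alpha> \<beta> where *: "\<alpha> \<in> X" "\<beta> \<in> Y" "\<phi> = \<alpha> \<otimes>\<^bsub>thompson_G\<^esub> \<beta>"
    unfolding S set_mult_def by blast
  show "\<exists>!(\<alpha>, \<beta>). \<alpha> \<in> X \<and> \<beta> \<in> Y \<and> \<phi> = \<alpha> \<otimes>\<^bsub>thompson_G\<^esub> \<beta>"
  proof (rule ex1I[of _ "(\<alpha>, \<beta>)"])
    show "case (\<alpha>, \<beta>) of (\<alpha>, \<beta>) \<Rightarrow> \<alpha> \<in> X \<and> \<beta> \<in> Y \<and> \<phi> = \<alpha> \<otimes>\<^bsub>thompson_G\<^esub> \<beta>"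
      using * by simp
    fix p assume p: "case p of (\<alpha>, \<beta>) \<Rightarrow> \<alpha> \<in> X \<and> \<beta> \<in> Y \<and> \<phi> = \<alpha> \<otimes>\<^bsub>thompson_G\<^esub> \<beta>"
    then show "p = (\<alpha>, \<beta>)"
      using set_mult_unique_factors[OF assms(1-3) *(1) _ *(2)] *(3) by (cases p) auto
  qed
qed

text \<open>An instance of the modular law: in a factorization of an element of T the factor from F
  is already in T, so the length-preserving factor is too.\<close>

lemma thompson_T_eq_lp_T_mult_thompson_F:
  "thompson_T = lp_T <#>\<^bsub>thompson_G\<^esub> (thompson_F :: 'a::{finite,linorder} wmap set)"
proof (intro equalityI subsetI)
  interpret group "thompson_G :: 'a wmap monoid" by (rule group_thompson_G)
  fix \<phi> :: "'a wmap" assume \<phi>: "\<phi> \<in> thompson_T"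
  then have "\<phi> \<in> lp_G <#>\<^bsub>thompson_G\<^esub> thompson_F"
    using carrier_eq_lp_G_mult_thompson_F by (auto simp: thompson_T_eq)
  then obtain \<pi> f where *: "\<pi> \<in> lp_G" "f \<in> thompson_F" "\<phi> = \<pi> \<otimes>\<^bsub>thompson_G\<^esub> f"
    unfolding set_mult_def by blast
  have c: "\<pi> \<in> carrier thompson_G" "f \<in> carrier thompson_G"
    using * by (auto simp: lp_G_eq thompson_F_eq)
  have "f \<in> thompson_T" using * thompson_F_subset_T by blast
  then have "\<phi> \<otimes>\<^bsub>thompson_G\<^esub> inv\<^bsub>thompson_G\<^esub> f \<in> thompson_T"
    using \<phi> subgroup.m_closed[OF subgroup_thompson_T] subgroup.m_inv_closed[OF subgroup_thompson_T]
    by blast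
  moreover have "\<phi> \<otimes>\<^bsub>thompson_G\<^esub> inv\<^bsub>thompson_G\<^esub> f = \<pi>"
    using c *(3) by (simp add: m_assoc)
  ultimately have "\<pi> \<in> lp_T" using *(1) by (simp add: lp_T_def)
  with * show "\<phi> \<in> lp_T <#>\<^bsub>thompson_G\<^esub> thompson_F" unfolding set_mult_def by blast
next
  fix \<phi> :: "'a wmap" assume "\<phi> \<in> lp_T <#>\<^bsub>thompson_G\<^esub> thompson_F"
  then show "\<phi> \<in> thompson_T"
    using thompson_F_subset_T subgroup.m_closed[OF subgroup_thompson_T]
    unfolding set_mult_def lp_T_def by blast
qed

theorem theorem3p2:
  assumes "card (UNIV :: 'a::{finite, linorder} set) \<ge> 2"
  shows
    "(carrier thompson_G = lp_G <#>\<^bsub>thompson_G\<^esub> (thompson_F :: 'a wmap set) \<and>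
      unique_factorization (carrier thompson_G) lp_G (thompson_F :: 'a wmap set)) \<and>
     (carrier thompson_G = (thompson_F :: 'a wmap set) <#>\<^bsub>thompson_G\<^esub> lp_G \<and>
      unique_factorization (carrier thompson_G) (thompson_F :: 'a wmap set) lp_G) \<and>
     (thompson_T = lp_T <#>\<^bsub>thompson_G\<^esub> (thompson_F :: 'a wmap set) \<and>
      unique_factorization thompson_T lp_T (thompson_F :: 'a wmap set)) \<and>
     (thompson_T = (thompson_F :: 'a wmap set) <#>\<^bsub>thompson_G\<^esub> lp_T \<and>
      unique_factorization thompson_T (thompson_F :: 'a wmap set) lp_T)"
proof -
  interpret group "thompson_G :: 'a wmap monoid" by (rule group_thompson_G)
  note F = subgroup_thompson_F[where 'a = 'a] and G = subgroup_lp_G[where 'a = 'a]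
    and T = subgroup_thompson_T[where 'a = 'a]
  have L: "subgroup (lp_T :: 'a wmap set) thompson_G"
    unfolding lp_T_def by (rule subgroups_Inter_pair[OF T G])
  have I: "lp_G \<inter> (thompson_F :: 'a wmap set) = {\<one>\<^bsub>thompson_G\<^esub>}"
    "(thompson_F :: 'a wmap set) \<inter> lp_G = {\<one>\<^bsub>thompson_G\<^esub>}"
    using lp_G_Int_thompson_F by blast+
  have J: "lp_T \<inter> (thompson_F :: 'a wmap set) = {\<one>\<^bsub>thompson_G\<^esub>}"
    "(thompson_F :: 'a wmap set) \<inter> lp_T = {\<one>\<^bsub>thompson_G\<^esub>}"
    using I thompson_F_subset_T unfolding lp_T_def by blast+
  note G1 = carrier_eq_lp_G_mult_thompson_F[where 'a = 'a]
    and T1 = thompson_T_eq_lp_T_mult_thompson_F[where 'a = 'a]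
  note G2 = set_mult_commute_if_subgroup[OF subgroup_self G F G1]
    and T2 = set_mult_commute_if_subgroup[OF T L F T1]
  show ?thesis
    using G1 G2 T1 T2
      unique_factorization_if_trivial_Int[OF G F I(1) G1]
      unique_factorization_if_trivial_Int[OF F G I(2) G2]
      unique_factorization_if_trivial_Int[OF L F J(1) T1]
      unique_factorization_if_trivial_Int[OF F L J(2) T2]
    by (intro conjI)
qed

end
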